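(* Let $A$ be a positive ordered commutative monoid with generator $\$$. The following are equivalent: (a) $\mathrm{aovs}_{\mathbb{Q}}(A)$ is numerical. (b) There is a functional $f:A\to\mathbb{R}$ such that every other functional on $A$ is a scalar multiple of $f$. (c) If $f:A\to\mathbb{R}$ is a nonzero functional, then every other functional on $A$ is a scalar multiple of $f$. (d) For all $x\in A$: if $R^{\mathrm{reg}}_{\max}(\$\to x)<\infty$, then $R^{\mathrm{reg}}_{\max}(\$\to x)\cdot R^{\mathrm{reg}}_{\max}(x\to\$)=1$. (e) For all $x,y\in A$: if $R^{\mathrm{reg}}_{\max}(x\to y)<\infty$ and $R^{\mathrm{reg}}_{\max}(y\to x)<\infty$, then $R^{\mathrm{reg}}_{\max}(x\to y)\cdot R^{\mathrm{reg}}_{\max}(y\to x)=1$. (f) There exists a functional $f:A\to\mathbb{R}_{\geq0}$ such that for all $x,y\in A$: $x\geq y$ in $\mathrm{aovs}_{\mathbb{Q}}(A)$ if and only if $f(x)\geq f(y)$.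
   Context: $\mathbb{N}=\{0,1,2,\dots\}$. An ordered commutative monoid is a set $A$ with a partial order $\geq$ and a commutative monoid structure $(+,0)$ such that $x\geq y$ implies $x+z\geq y+z$; $nx$ denotes the $n$-fold sum. $A$ is positive if $x\geq0$ for all $x\in A$. In this case a generator is an element $\$\in A$ such that for every $x\in A$ there is $n\in\mathbb{N}$ with $n\$\geq x$. A functional on $A$ is a map $f:A\to\mathbb{R}$ with $x\geq y\Rightarrow f(x)\geq f(y)$, $f(x+y)=f(x)+f(y)$, $f(0)=0$. An ordered commutative monoid $B$ is numerical if there is a functional $f$ on $B$ with $x\geq y\Leftrightarrow f(x)\geq f(y)$ for all $x,y\in B$. Regularized rates: a fraction $\tfrac mn$ means a pair $m,n\in\mathbb{N}$, not both zero, interpreted in $[0,\infty]$ ($\tfrac m0=\infty$ for $m>0$). A number $r\in\mathbb{R}_{\geq0}\cup\{\infty\}$ is a regularized rate from $x$ to $y$ if for every $\varepsilon>0$ and every neighbourhood of $r$ in $[0,\infty]$ there exist a fraction $\tfrac mn$ in it and $k\in\mathbb{N}$ with $k\leq\varepsilon\max(m,n)$ and $nx+k\$\geq my$. The set of regularized rates is a closed interval, and $R^{\mathrm{reg}}_{\max}(x\to y)\in[0,\infty]$ is its largest element. Regularizations (in each case elements ordered both ways are identified): $\mathrm{oag}(A)$ is the abelian group of formal differences $x-y$ ($x,y\in A$), with $x-y\geq x'-y'$ iff there is $z\in A$ with $x+y'+z\geq x'+y+z$. $\mathrm{ovs}_{\mathbb{Q}}(A)$ is the $\mathbb{Q}$-vector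 space of formal fractions $\tfrac1n u$ ($n\geq1$, $u\in\mathrm{oag}(A)$), with $\tfrac1m u\geq\tfrac1n v$ iff $jnu\geq jmv$ in $\mathrm{oag}(A)$ for some integer $j\geq1$. For an ordered $\mathbb{Q}$-vector space $V$ with positive cone $V_+$, call $U\subseteq V$ absolutely convex if it is closed under convex combinations with rational coefficients and $V_+\subseteq U$, and absorbent if for every $v\in V$ there is a rational $\mu>0$ with $\mu v\in U$; $\mathrm{aovs}_{\mathbb{Q}}(V)$ is $V$ with new positive cone the intersection of all absolutely convex absorbent subsets of $V$. $\mathrm{aovs}_{\mathbb{Q}}(A):=\mathrm{aovs}_{\mathbb{Q}}(\mathrm{ovs}_{\mathbb{Q}}(A))$. "$x\geq y$ in $\mathrm{aovs}_{\mathbb{Q}}(A)$" refers to the images of $x,y$ under the canonical homomorphism. *)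

theory Defs
  imports "HOL-Analysis.Analysis"
begin

section \<open>Ordered commutative monoids and functionals\<close>

text \<open>
  An ordered commutative monoid is a type of class \<^class>\<open>ordered_comm_monoid_add\<close>:
  a commutative monoid with a partial order for which addition is monotone.
\<close>

primrec nmult :: "nat \<Rightarrow> 'a::comm_monoid_add \<Rightarrow> 'a"  (infixr "\<cdot>\<^sub>N" 75) where
  "0 \<cdot>\<^sub>N x = 0"
| "Suc n \<cdot>\<^sub>N x = x + n \<cdot>\<^sub>N x"

definition generator :: "'a::ordered_comm_monoid_add \<Rightarrow> bool" where
  "generator d \<longleftrightarrow> (\<forall>x. \<exists>n. n \<cdot>\<^sub>N d \<ge> x)"

definition functional :: "('a::ordered_comm_monoid_add \<Rightarrow> real) \<Rightarrow> bool" where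
  "functional f \<longleftrightarrow>
     (\<forall>x y. x \<ge> y \<longrightarrow> f x \<ge> f y) \<and> (\<forall>x y. f (x + y) = f x + f y) \<and> f 0 = 0"

definition numerical :: "'b::ordered_comm_monoid_add itself \<Rightarrow> bool" where
  "numerical _ \<longleftrightarrow>
     (\<exists>f::'b \<Rightarrow> real. functional f \<and> (\<forall>x y. x \<ge> y \<longleftrightarrow> f x \<ge> f y))"


section \<open>Regularized rates\<close>

text \<open>
  The interval $[0,\infty]$ is \<^typ>\<open>ennreal\<close>. Division there satisfies $m / 0 = \infty$
  for $m > 0$, so \<^term>\<open>of_nat m / of_nat n :: ennreal\<close> is the intended value of the
  fraction $m/n$ whenever $m$ and $n$ are not both zero. It suffices to consider open
  neighbourhoods.
\<close>

definition regularized_rate ::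
    "'a::ordered_comm_monoid_add \<Rightarrow> 'a \<Rightarrow> 'a \<Rightarrow> ennreal \<Rightarrow> bool" where
  "regularized_rate d x y r \<longleftrightarrow>
     (\<forall>\<epsilon>::real. \<epsilon> > 0 \<longrightarrow> (\<forall>U. open U \<and> r \<in> U \<longrightarrow>
        (\<exists>m n k :: nat. (m \<noteq> 0 \<or> n \<noteq> 0) \<and> of_nat m / of_nat n \<in> U \<and>
           real k \<le> \<epsilon> * real (max m n) \<and> n \<cdot>\<^sub>N x + k \<cdot>\<^sub>N d \<ge> m \<cdot>\<^sub>N y)))"

definition Rmax_reg :: "'a::ordered_comm_monoid_add \<Rightarrow> 'a \<Rightarrow> 'a \<Rightarrow> ennreal" where
  "Rmax_reg d x y = (GREATEST r. regularized_rate d x y r)"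

lemma regularized_rate_zero:
  fixes d x y :: "'a::ordered_comm_monoid_add"
  assumes pos: "\<And>z::'a. z \<ge> 0"
  shows "regularized_rate d x y 0"
  unfolding regularized_rate_def
proof (intro allI impI)
  fix \<epsilon> :: real and U :: "ennreal set"
  assume "\<epsilon> > 0" "open U \<and> 0 \<in> U"
  then show "\<exists>m n k :: nat. (m \<noteq> 0 \<or> n \<noteq> 0) \<and> of_nat m / of_nat n \<in> U \<and>
      real k \<le> \<epsilon> * real (max m n) \<and> n \<cdot>\<^sub>N x + k \<cdot>\<^sub>N d \<ge> m \<cdot>\<^sub>N y"
    by (intro exI[of _ 0] exI[of _ 1]) (auto simp: pos)
qed

lemma closed_regularized_rates: "closed {r. regularized_rate d x y r}"
proof -
  have "regularized_rate d x y r" if r: "r \<in> closure {r. regularized_rate d x y r}" for r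
    unfolding regularized_rate_def
  proof (intro allI impI)
    fix \<epsilon> :: real and U :: "ennreal set"
    assume \<epsilon>: "\<epsilon> > 0" and U: "open U \<and> r \<in> U"
    then obtain s where "s \<in> U" "regularized_rate d x y s"
      using r open_Int_closure_eq_empty[of U "{r. regularized_rate d x y r}"] by blast
    then show "\<exists>m n k :: nat. (m \<noteq> 0 \<or> n \<noteq> 0) \<and> of_nat m / of_nat n \<in> U \<and>
        real k \<le> \<epsilon> * real (max m n) \<and> n \<cdot>\<^sub>N x + k \<cdot>\<^sub>N d \<ge> m \<cdot>\<^sub>N y"
      using \<epsilon> U unfolding regularized_rate_def by blast
  qed
  then have "closure {r. regularized_rate d x y r} = {r. regularized_rate d x y r}"
    using closure_subset by blast
  then show ?thesis by (metis closed_closure)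
qed

text \<open>So over a positive monoid the greatest element in \<^const>\<open>Rmax_reg\<close> always exists.\<close>

lemma
  fixes d x y :: "'a::ordered_comm_monoid_add"
  assumes pos: "\<And>z::'a. z \<ge> 0"
  shows regularized_rate_Rmax_reg: "regularized_rate d x y (Rmax_reg d x y)"
    and regularized_rate_le_Rmax_reg: "regularized_rate d x y r \<Longrightarrow> r \<le> Rmax_reg d x y"
proof -
  let ?S = "{r. regularized_rate d x y r}"
  have "Sup ?S \<in> ?S"
    using regularized_rate_zero[OF pos, of d x y]
    by (intro closed_contains_Sup_cl closed_regularized_rates) auto
  moreover have "Rmax_reg d x y = Sup ?S"
    unfolding Rmax_reg_def using calculation
    by (intro Greatest_equality) (auto intro: Sup_upper)
  ultimately show "regularized_rate d x y (Rmax_reg d x y)"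
    and "regularized_rate d x y r \<Longrightarrow> r \<le> Rmax_reg d x y"
    by (auto intro: Sup_upper)
qed


section \<open>The ordered abelian group of an ordered commutative monoid\<close>

text \<open>The pair $(x, y)$ stands for the formal difference $x - y$.\<close>

fun oag_le :: "'a::ordered_comm_monoid_add \<times> 'a \<Rightarrow> 'a \<times> 'a \<Rightarrow> bool" where
  "oag_le (x', y') (x, y) \<longleftrightarrow> (\<exists>z. x + y' + z \<ge> x' + y + z)"

lemma oag_le_refl: "oag_le p p"
  by (cases p) (auto simp: add.commute)

lemma oag_le_trans: "oag_le p q \<Longrightarrow> oag_le q r \<Longrightarrow> oag_le p r"
proof (cases p, cases q, cases r)
  fix a b c d e f :: 'a
  assume "oag_le p q" "oag_le q r" and eqs: "p = (a, b)" "q = (c, d)" "r = (e, f)"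
  then obtain z w where "a + d + z \<le> c + b + z" "c + f + w \<le> e + d + w"
    by auto
  then have "(a + d + z) + (c + f + w) \<le> (c + b + z) + (e + d + w)"
    by (rule add_mono)
  then have "a + f + (c + d + z + w) \<le> e + b + (c + d + z + w)"
    by (simp add: ac_simps)
  then show "oag_le p r"
    unfolding eqs oag_le.simps by blast
qed

lemma oag_le_plus:
  assumes "oag_le p q" "oag_le p' q'"
  shows "oag_le (fst p + fst p', snd p + snd p') (fst q + fst q', snd q + snd q')"
proof (cases p, cases q, cases p', cases q')
  fix a b c d a' b' c' d' :: 'a
  assume eqs: "p = (a, b)" "q = (c, d)" "p' = (a', b')" "q' = (c', d')"
  with assms obtain z w where "a + d + z \<le> c + b + z" "a' + d' + w \<le> c' + b' + w"
    by auto
  then have "(a + d + z) + (a' + d' + w) \<le> (c + b + z) + (c' + b' + w)"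
    by (rule add_mono)
  then have "(a + a') + (d + d') + (z + w) \<le> (c + c') + (b + b') + (z + w)"
    by (simp add: ac_simps)
  then show ?thesis
    unfolding eqs fst_conv snd_conv oag_le.simps by blast
qed

lemma oag_le_swap: "oag_le p q \<Longrightarrow> oag_le (snd q, fst q) (snd p, fst p)"
  by (cases p; cases q) (auto simp: add.commute)

definition oag_eq :: "'a::ordered_comm_monoid_add \<times> 'a \<Rightarrow> 'a \<times> 'a \<Rightarrow> bool" where
  "oag_eq p q \<longleftrightarrow> oag_le p q \<and> oag_le q p"

lemma equivp_oag_eq: "equivp oag_eq"
  by (intro equivpI reflpI sympI transpI)
     (auto simp: oag_eq_def oag_le_refl intro: oag_le_trans)

quotient_type (overloaded) 'a oag = "'a::ordered_comm_monoid_add \<times> 'a" / oag_eq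
  by (rule equivp_oag_eq)

instantiation oag :: (ordered_comm_monoid_add) ordered_ab_group_add
begin

lift_definition zero_oag :: "'a oag" is "(0, 0)" .

lift_definition plus_oag :: "'a oag \<Rightarrow> 'a oag \<Rightarrow> 'a oag"
  is "\<lambda>p q. (fst p + fst q, snd p + snd q)"
  unfolding oag_eq_def by (blast intro: oag_le_plus)

lift_definition uminus_oag :: "'a oag \<Rightarrow> 'a oag" is "\<lambda>p. (snd p, fst p)"
  unfolding oag_eq_def by (blast intro: oag_le_swap)

definition minus_oag :: "'a oag \<Rightarrow> 'a oag \<Rightarrow> 'a oag" where
  "minus_oag u v = u + - v"

lift_definition less_eq_oag :: "'a oag \<Rightarrow> 'a oag \<Rightarrow> bool" is oag_le
  unfolding oag_eq_def by (blast intro: oag_le_trans)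

definition less_oag :: "'a oag \<Rightarrow> 'a oag \<Rightarrow> bool" where
  "less_oag u v \<longleftrightarrow> u \<le> v \<and> \<not> v \<le> u"

instance
proof
  fix u v w :: "'a oag"
  show "u + v + w = u + (v + w)" by transfer (simp add: oag_eq_def oag_le_refl add.assoc)
  show "u + v = v + u" by transfer (simp add: oag_eq_def oag_le_refl add.commute)
  show "0 + u = u" by transfer (simp add: oag_eq_def oag_le_refl)
  show "- u + u = 0" by transfer (auto simp: oag_eq_def add.commute)
  show "u - v = u + - v" by (rule minus_oag_def)
  show "u < v \<longleftrightarrow> u \<le> v \<and> \<not> v \<le> u" by (rule less_oag_def)
  show "u \<le> u" by transfer (rule oag_le_refl)
  show "u \<le> v \<Longrightarrow> v \<le> w \<Longrightarrow> u \<le> w" by transfer (rule oag_le_trans)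
  show "u \<le> v \<Longrightarrow> v \<le> u \<Longrightarrow> u = v" by transfer (simp add: oag_eq_def)
  show "u \<le> v \<Longrightarrow> w + u \<le> w + v"
    by transfer (rule oag_le_plus[OF oag_le_refl])
qed

end

lift_definition to_oag :: "'a::ordered_comm_monoid_add \<Rightarrow> 'a oag" is "\<lambda>x. (x, 0)" .


section \<open>Integer multiples\<close>

definition zmult :: "int \<Rightarrow> 'a::ab_group_add \<Rightarrow> 'a"  (infixr "\<cdot>\<^sub>Z" 75) where
  "k \<cdot>\<^sub>Z x = (if k \<ge> 0 then nat k \<cdot>\<^sub>N x else - (nat (- k) \<cdot>\<^sub>N x))"

lemma nmult_zero_right [simp]: "n \<cdot>\<^sub>N 0 = 0"
  by (induction n) simp_all

lemma nmult_add_left: "(m + n) \<cdot>\<^sub>N x = m \<cdot>\<^sub>N x + n \<cdot>\<^sub>N x"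
  by (induction m) (simp_all add: add.assoc)

lemma nmult_add_right: "n \<cdot>\<^sub>N (x + y) = n \<cdot>\<^sub>N x + n \<cdot>\<^sub>N y"
  by (induction n) (simp_all add: ac_simps)

lemma nmult_nmult: "m \<cdot>\<^sub>N n \<cdot>\<^sub>N x = (m * n) \<cdot>\<^sub>N x"
  by (induction m) (simp_all add: nmult_add_left)

lemma nmult_minus: "n \<cdot>\<^sub>N (- x) = - (n \<cdot>\<^sub>N (x :: 'a::ab_group_add))"
  by (induction n) simp_all

lemma nmult_mono: "x \<le> y \<Longrightarrow> n \<cdot>\<^sub>N x \<le> n \<cdot>\<^sub>N (y :: 'a::ordered_comm_monoid_add)"
  by (induction n) (simp_all add: add_mono)

lemma zmult_of_nat: "int n \<cdot>\<^sub>Z x = n \<cdot>\<^sub>N x"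
  by (simp add: zmult_def)

lemma zmult_diff_of_nat: "(int m - int n) \<cdot>\<^sub>Z x = m \<cdot>\<^sub>N x - n \<cdot>\<^sub>N x"
proof (cases "n \<le> m")
  case True
  then obtain k where "m = n + k" using le_Suc_ex by blast
  then show ?thesis by (simp add: zmult_def nmult_add_left)
next
  case False
  then obtain k where "n = m + k" "k > 0"
    using less_imp_add_positive not_le by metis
  then show ?thesis by (simp add: zmult_def nmult_add_left)
qed

lemma zmult_add_left: "(a + b) \<cdot>\<^sub>Z x = a \<cdot>\<^sub>Z x + b \<cdot>\<^sub>Z x"
proof -
  obtain m n m' n' where eqs: "a = int m - int n" "b = int m' - int n'"
    by (metis int_diff_cases)
  have "(a + b) \<cdot>\<^sub>Z x = (int (m + m') - int (n + n')) \<cdot>\<^sub>Z x"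
    by (simp add: eqs algebra_simps)
  then show ?thesis
    unfolding zmult_diff_of_nat by (simp add: eqs zmult_diff_of_nat nmult_add_left)
qed

lemma zmult_add_right: "a \<cdot>\<^sub>Z (x + y) = a \<cdot>\<^sub>Z x + a \<cdot>\<^sub>Z y"
  by (simp add: zmult_def nmult_add_right)

lemma zmult_minus_right: "a \<cdot>\<^sub>Z (- x) = - (a \<cdot>\<^sub>Z x)"
  by (simp add: zmult_def nmult_minus)

lemma zmult_zmult: "a \<cdot>\<^sub>Z b \<cdot>\<^sub>Z x = (a * b) \<cdot>\<^sub>Z x"
proof -
  obtain m n m' n' where eqs: "a = int m - int n" "b = int m' - int n'"
    by (metis int_diff_cases)
  have "(a * b) \<cdot>\<^sub>Z x = (int (m * m' + n * n') - int (m * n' + n * m')) \<cdot>\<^sub>Z x"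
    by (simp add: eqs algebra_simps)
  also have "\<dots> = m \<cdot>\<^sub>N (m' \<cdot>\<^sub>N x + - (n' \<cdot>\<^sub>N x)) - n \<cdot>\<^sub>N (m' \<cdot>\<^sub>N x + - (n' \<cdot>\<^sub>N x))"
    unfolding zmult_diff_of_nat nmult_add_right nmult_minus
    by (simp add: nmult_add_left nmult_nmult)
  finally show ?thesis by (simp add: eqs zmult_diff_of_nat)
qed

lemma zmult_mono:
  "0 \<le> a \<Longrightarrow> x \<le> y \<Longrightarrow> a \<cdot>\<^sub>Z x \<le> a \<cdot>\<^sub>Z (y :: 'a::ordered_ab_group_add)"
  by (simp add: zmult_def nmult_mono)

lemma zmult_zero [simp]: "a \<cdot>\<^sub>Z 0 = 0"
  using zmult_add_right[of a 0 0] by simp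

lemma zmult_one [simp]: "1 \<cdot>\<^sub>Z x = x"
  by (simp add: zmult_def)


section \<open>Ordered vector spaces over the rationals\<close>

class ordered_rat_vector = ordered_ab_group_add +
  fixes scaleQ :: "rat \<Rightarrow> 'a \<Rightarrow> 'a"  (infixr "*\<^sub>Q" 75)
  assumes scaleQ_add_right: "q *\<^sub>Q (x + y) = q *\<^sub>Q x + q *\<^sub>Q y"
    and scaleQ_add_left: "(p + q) *\<^sub>Q x = p *\<^sub>Q x + q *\<^sub>Q x"
    and scaleQ_scaleQ: "p *\<^sub>Q q *\<^sub>Q x = (p * q) *\<^sub>Q x"
    and scaleQ_one: "1 *\<^sub>Q x = x"
    and scaleQ_left_mono: "x \<le> y \<Longrightarrow> 0 \<le> q \<Longrightarrow> q *\<^sub>Q x \<le> q *\<^sub>Q y"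

text \<open>The pair $(n, u)$ with $n \geq 1$ stands for the formal fraction $\frac{1}{n} u$.\<close>

fun ovs_le :: "nat \<times> 'g::ordered_ab_group_add \<Rightarrow> nat \<times> 'g \<Rightarrow> bool" where
  "ovs_le (n, v) (m, u) \<longleftrightarrow> (\<exists>j\<ge>1. (j * n) \<cdot>\<^sub>N u \<ge> (j * m) \<cdot>\<^sub>N v)"

definition ovs_eq :: "nat \<times> 'g::ordered_ab_group_add \<Rightarrow> nat \<times> 'g \<Rightarrow> bool" where
  "ovs_eq p q \<longleftrightarrow> fst p \<ge> 1 \<and> fst q \<ge> 1 \<and> ovs_le p q \<and> ovs_le q p"

lemma ovs_le_iff:
  "ovs_le (n, v) (m, u) \<longleftrightarrow> (\<exists>j>0. (j * int m) \<cdot>\<^sub>Z v \<le> (j * int n) \<cdot>\<^sub>Z u)"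
proof
  assume "ovs_le (n, v) (m, u)"
  then obtain j where "j \<ge> 1" "(j * m) \<cdot>\<^sub>N v \<le> (j * n) \<cdot>\<^sub>N u" by auto
  then show "\<exists>j>0. (j * int m) \<cdot>\<^sub>Z v \<le> (j * int n) \<cdot>\<^sub>Z u"
    by (intro exI[of _ "int j"]) (simp flip: zmult_of_nat)
next
  assume "\<exists>j>0. (j * int m) \<cdot>\<^sub>Z v \<le> (j * int n) \<cdot>\<^sub>Z u"
  then obtain j where "j > 0" "(j * int m) \<cdot>\<^sub>Z v \<le> (j * int n) \<cdot>\<^sub>Z u" by auto
  then show "ovs_le (n, v) (m, u)"
    by (auto intro!: exI[of _ "nat j"] simp flip: zmult_of_nat)
qed

lemma ovs_eq_iff:
  "ovs_eq (n, v) (m, u) \<longleftrightarrow>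
     n > 0 \<and> m > 0 \<and> (\<exists>j>0. (j * int m) \<cdot>\<^sub>Z v = (j * int n) \<cdot>\<^sub>Z u)"
proof
  assume "ovs_eq (n, v) (m, u)"
  then obtain j k where *: "n > 0" "m > 0" "j > 0" "k > 0"
      "(j * int m) \<cdot>\<^sub>Z v \<le> (j * int n) \<cdot>\<^sub>Z u" "(k * int n) \<cdot>\<^sub>Z u \<le> (k * int m) \<cdot>\<^sub>Z v"
    unfolding ovs_eq_def ovs_le_iff by auto
  have "k \<cdot>\<^sub>Z (j * int m) \<cdot>\<^sub>Z v \<le> k \<cdot>\<^sub>Z (j * int n) \<cdot>\<^sub>Z u"
    "j \<cdot>\<^sub>Z (k * int n) \<cdot>\<^sub>Z u \<le> j \<cdot>\<^sub>Z (k * int m) \<cdot>\<^sub>Z v"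
    using * by (auto intro: zmult_mono)
  then have "(k * j * int m) \<cdot>\<^sub>Z v = (k * j * int n) \<cdot>\<^sub>Z u"
    by (intro order.antisym) (simp_all add: zmult_zmult ac_simps)
  then show "n > 0 \<and> m > 0 \<and> (\<exists>j>0. (j * int m) \<cdot>\<^sub>Z v = (j * int n) \<cdot>\<^sub>Z u)"
    using * by (auto intro!: exI[of _ "k * j"])
next
  assume "n > 0 \<and> m > 0 \<and> (\<exists>j>0. (j * int m) \<cdot>\<^sub>Z v = (j * int n) \<cdot>\<^sub>Z u)"
  then show "ovs_eq (n, v) (m, u)"
    unfolding ovs_eq_def ovs_le_iff by (auto intro: eq_refl)
qed

lemma ovs_eqI:
  assumes "n > 0" "m > 0" "int m \<cdot>\<^sub>Z v = int n \<cdot>\<^sub>Z u"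
  shows "ovs_eq (n, v) (m, u)"
  using assms unfolding ovs_eq_iff by (auto intro!: exI[of _ 1])

lemma ovs_eq_refl_iff: "ovs_eq (n, u) (n, u) \<longleftrightarrow> n > 0"
  by (auto simp: ovs_eq_iff intro!: exI[of _ 1])

lemma ovs_le_trans:
  assumes "ovs_le p q" "ovs_le q r" "fst q \<ge> 1"
  shows "ovs_le p r"
proof (cases p, cases q, cases r)
  fix a u b v c w
  assume eqs: "p = (a, u)" "q = (b, v)" "r = (c, w)"
  with assms obtain j k where *: "b > 0" "j > 0" "k > 0"
      "(j * int b) \<cdot>\<^sub>Z u \<le> (j * int a) \<cdot>\<^sub>Z v" "(k * int c) \<cdot>\<^sub>Z v \<le> (k * int b) \<cdot>\<^sub>Z w"
    unfolding eqs ovs_le_iff by auto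
  have "(k * int c) \<cdot>\<^sub>Z (j * int b) \<cdot>\<^sub>Z u \<le> (k * int c) \<cdot>\<^sub>Z (j * int a) \<cdot>\<^sub>Z v"
    using * by (intro zmult_mono) auto
  also have "\<dots> = (j * int a) \<cdot>\<^sub>Z (k * int c) \<cdot>\<^sub>Z v"
    by (simp add: zmult_zmult ac_simps)
  also have "\<dots> \<le> (j * int a) \<cdot>\<^sub>Z (k * int b) \<cdot>\<^sub>Z w"
    using * by (intro zmult_mono) auto
  finally have "((k * j * int b) * int c) \<cdot>\<^sub>Z u \<le> ((k * j * int b) * int a) \<cdot>\<^sub>Z w"
    by (simp add: zmult_zmult ac_simps)
  moreover have "k * j * int b > 0" using * by simp
  ultimately show "ovs_le p r"
    unfolding eqs ovs_le_iff by blast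
qed

lemma part_equivp_ovs_eq: "part_equivp ovs_eq"
proof (rule part_equivpI)
  show "\<exists>x. ovs_eq x x" by (rule exI[of _ "(1, 0)"]) (auto simp: ovs_eq_def)
  show "symp ovs_eq" by (rule sympI) (auto simp: ovs_eq_def)
  show "transp ovs_eq" by (rule transpI) (auto simp: ovs_eq_def intro: ovs_le_trans)
qed

quotient_type (overloaded) 'g ovs = "nat \<times> 'g::ordered_ab_group_add" / partial: ovs_eq
  by (rule part_equivp_ovs_eq)

fun ovs_plus :: "nat \<times> 'g::ordered_ab_group_add \<Rightarrow> nat \<times> 'g \<Rightarrow> nat \<times> 'g" where
  "ovs_plus (m, u) (n, v) = (m * n, n \<cdot>\<^sub>N u + m \<cdot>\<^sub>N v)"

fun ovs_uminus :: "nat \<times> 'g::ordered_ab_group_add \<Rightarrow> nat \<times> 'g" where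
  "ovs_uminus (m, u) = (m, - u)"

fun ovs_scale :: "rat \<Rightarrow> nat \<times> 'g::ordered_ab_group_add \<Rightarrow> nat \<times> 'g" where
  "ovs_scale q (m, u) = (case quotient_of q of (a, b) \<Rightarrow> (nat b * m, a \<cdot>\<^sub>Z u))"

lemma ovs_le_plus_left:
  assumes "fst p \<ge> 1" "ovs_le q r"
  shows "ovs_le (ovs_plus p q) (ovs_plus p r)"
proof (cases p, cases q, cases r)
  fix a u b v c w
  assume eqs: "p = (a, u)" "q = (b, v)" "r = (c, w)"
  with assms obtain j where *: "a > 0" "j > 0" "(j * int c) \<cdot>\<^sub>Z v \<le> (j * int b) \<cdot>\<^sub>Z w"
    unfolding eqs ovs_le_iff by auto
  have "(int a * int a) \<cdot>\<^sub>Z (j * int c) \<cdot>\<^sub>Z v \<le> (int a * int a) \<cdot>\<^sub>Z (j * int b) \<cdot>\<^sub>Z w"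
    using * by (intro zmult_mono) auto
  then have "(j * int (a * c)) \<cdot>\<^sub>Z (int b \<cdot>\<^sub>Z u + int a \<cdot>\<^sub>Z v)
      \<le> (j * int (a * b)) \<cdot>\<^sub>Z (int c \<cdot>\<^sub>Z u + int a \<cdot>\<^sub>Z w)"
    by (simp add: zmult_zmult zmult_add_right ac_simps)
  with *(2) show ?thesis
    unfolding eqs ovs_plus.simps ovs_le_iff zmult_of_nat by blast
qed

lemma ovs_plus_commute: "ovs_plus p q = ovs_plus q p"
  by (cases p; cases q) (simp add: ac_simps)

lemma fst_ovs_plus: "fst (ovs_plus p q) = fst p * fst q"
  by (cases p; cases q) simp

lemma ovs_eq_plus:
  assumes "ovs_eq p q" "ovs_eq p' q'"
  shows "ovs_eq (ovs_plus p p') (ovs_plus q q')"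
proof -
  have le: "ovs_le (ovs_plus p p') (ovs_plus q q')" if "ovs_eq p q" "ovs_eq p' q'"
    for p q p' q' :: "nat \<times> 'a"
  proof (rule ovs_le_trans)
    show "ovs_le (ovs_plus p p') (ovs_plus p q')"
      using that by (intro ovs_le_plus_left) (auto simp: ovs_eq_def)
    show "ovs_le (ovs_plus p q') (ovs_plus q q')"
      using that unfolding ovs_plus_commute[of _ q']
      by (intro ovs_le_plus_left) (auto simp: ovs_eq_def)
    show "fst (ovs_plus p q') \<ge> 1"
      using that by (auto simp: fst_ovs_plus ovs_eq_def)
  qed
  have "ovs_eq q p" "ovs_eq q' p'"
    using assms by (auto simp: ovs_eq_def)
  with assms le[of p q p' q'] le[of q p q' p'] show ?thesis
    by (auto simp: fst_ovs_plus ovs_eq_def)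
qed

lemma ovs_eq_uminus: "ovs_eq p q \<Longrightarrow> ovs_eq (ovs_uminus p) (ovs_uminus q)"
  by (cases p; cases q) (auto simp: ovs_eq_iff zmult_minus_right)

lemma ovs_eq_scale:
  assumes "ovs_eq p q"
  shows "ovs_eq (ovs_scale r p) (ovs_scale r q)"
proof (cases p, cases q)
  fix m u n v
  assume eqs: "p = (m, u)" "q = (n, v)"
  obtain a b where ab: "quotient_of r = (a, b)" by force
  then have b: "b > 0" by (rule quotient_of_denom_pos)
  obtain j where *: "m > 0" "n > 0" "j > 0" "(j * int n) \<cdot>\<^sub>Z u = (j * int m) \<cdot>\<^sub>Z v"
    using assms unfolding eqs ovs_eq_iff by auto
  have "(a * b) \<cdot>\<^sub>Z (j * int n) \<cdot>\<^sub>Z u = (a * b) \<cdot>\<^sub>Z (j * int m) \<cdot>\<^sub>Z v"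
    using * by simp
  then have "(j * int (nat b * n)) \<cdot>\<^sub>Z a \<cdot>\<^sub>Z u = (j * int (nat b * m)) \<cdot>\<^sub>Z a \<cdot>\<^sub>Z v"
    using b by (simp add: zmult_zmult ac_simps)
  with * b show ?thesis
    unfolding eqs ovs_scale.simps ab prod.case ovs_eq_iff by auto
qed

lemma ovs_le_scale:
  assumes "ovs_le p q" "0 \<le> r"
  shows "ovs_le (ovs_scale r p) (ovs_scale r q)"
proof (cases p, cases q)
  fix m u n v
  assume eqs: "p = (m, u)" "q = (n, v)"
  obtain a b where ab: "quotient_of r = (a, b)" by force
  then have b: "b > 0" by (rule quotient_of_denom_pos)
  have "r = of_int a / of_int b" using ab by (rule quotient_of_div)
  with assms b have a: "a \<ge> 0" by (simp add: zero_le_divide_iff)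
  obtain j where *: "j > 0" "(j * int n) \<cdot>\<^sub>Z u \<le> (j * int m) \<cdot>\<^sub>Z v"
    using assms unfolding eqs ovs_le_iff by auto
  have "(a * b) \<cdot>\<^sub>Z (j * int n) \<cdot>\<^sub>Z u \<le> (a * b) \<cdot>\<^sub>Z (j * int m) \<cdot>\<^sub>Z v"
    using * a b by (intro zmult_mono) auto
  then have "(j * int (nat b * n)) \<cdot>\<^sub>Z a \<cdot>\<^sub>Z u \<le> (j * int (nat b * m)) \<cdot>\<^sub>Z a \<cdot>\<^sub>Z v"
    using b by (simp add: zmult_zmult ac_simps)
  with * show ?thesis
    unfolding eqs ovs_scale.simps ab prod.case ovs_le_iff by blast
qed

instantiation ovs :: (ordered_ab_group_add) ordered_rat_vector
begin

lift_definition zero_ovs :: "'a ovs" is "(1, 0)"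
  by (auto simp: ovs_eq_def)

lift_definition plus_ovs :: "'a ovs \<Rightarrow> 'a ovs \<Rightarrow> 'a ovs" is ovs_plus
  by (rule ovs_eq_plus)

lift_definition uminus_ovs :: "'a ovs \<Rightarrow> 'a ovs" is ovs_uminus
  by (rule ovs_eq_uminus)

definition minus_ovs :: "'a ovs \<Rightarrow> 'a ovs \<Rightarrow> 'a ovs" where
  "minus_ovs u v = u + - v"

lift_definition scaleQ_ovs :: "rat \<Rightarrow> 'a ovs \<Rightarrow> 'a ovs" is ovs_scale
  by (rule ovs_eq_scale)

lift_definition less_eq_ovs :: "'a ovs \<Rightarrow> 'a ovs \<Rightarrow> bool" is ovs_le
  unfolding ovs_eq_def by (blast intro: ovs_le_trans)

definition less_ovs :: "'a ovs \<Rightarrow> 'a ovs \<Rightarrow> bool" where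
  "less_ovs u v \<longleftrightarrow> u \<le> v \<and> \<not> v \<le> u"

instance
proof
  fix u v w :: "'a ovs" and p q :: rat
  have fst_pos: "fst x \<ge> 1" if "ovs_eq x x" for x :: "nat \<times> 'a"
    using that by (simp add: ovs_eq_def)
  show "u + v + w = u + (v + w)"
    by transfer
       (auto intro!: ovs_eqI simp: ovs_eq_refl_iff zmult_add_right zmult_zmult ac_simps
             simp flip: zmult_of_nat)
  show "u + v = v + u"
    by transfer (metis ovs_plus_commute ovs_eq_plus)
  show "0 + u = u"
    by transfer (auto intro!: ovs_eqI simp: ovs_eq_refl_iff)
  show "- u + u = 0"
    by transfer
       (auto intro!: ovs_eqI simp: ovs_eq_refl_iff zmult_add_right zmult_zmult zmult_minus_right
             simp flip: zmult_of_nat)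
  show "u - v = u + - v" by (rule minus_ovs_def)
  show "u < v \<longleftrightarrow> u \<le> v \<and> \<not> v \<le> u" by (rule less_ovs_def)
  show "u \<le> u" by transfer (simp add: ovs_eq_def)
  show "u \<le> v \<Longrightarrow> v \<le> w \<Longrightarrow> u \<le> w"
    by transfer (blast intro: ovs_le_trans fst_pos)
  show "u \<le> v \<Longrightarrow> v \<le> u \<Longrightarrow> u = v" by transfer (simp add: ovs_eq_def)
  show "u \<le> v \<Longrightarrow> w + u \<le> w + v"
    by transfer (blast intro: ovs_le_plus_left fst_pos)
  show "u \<le> v \<Longrightarrow> 0 \<le> q \<Longrightarrow> q *\<^sub>Q u \<le> q *\<^sub>Q v"
    by transfer (rule ovs_le_scale)
  show "1 *\<^sub>Q u = u"
    by transfer (auto intro!: ovs_eqI simp: ovs_eq_refl_iff)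
  obtain a b where ab: "quotient_of p = (a, b)" by force
  obtain c d where cd: "quotient_of q = (c, d)" by force
  have b: "b > 0" and d: "d > 0"
    using ab cd by (auto intro: quotient_of_denom_pos)
  show "q *\<^sub>Q (u + v) = q *\<^sub>Q u + q *\<^sub>Q v"
  proof (transfer fixing: q)
    fix x y :: "nat \<times> 'a"
    assume "ovs_eq x x" "ovs_eq y y"
    then obtain m w n z where xy: "x = (m, w)" "y = (n, z)" "m > 0" "n > 0"
      by (cases x; cases y) (auto simp: ovs_eq_refl_iff)
    have d': "int (nat d) = d" using d by simp
    have "int (nat d * m * (nat d * n)) \<cdot>\<^sub>Z c \<cdot>\<^sub>Z (int n \<cdot>\<^sub>Z w + int m \<cdot>\<^sub>Z z) =
        int (nat d * (m * n)) \<cdot>\<^sub>Z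
          (int (nat d * n) \<cdot>\<^sub>Z c \<cdot>\<^sub>Z w + int (nat d * m) \<cdot>\<^sub>Z c \<cdot>\<^sub>Z z)"
      unfolding zmult_add_right zmult_zmult of_nat_mult d'
      by (simp only: mult.assoc mult.commute mult.left_commute)
    then show "ovs_eq (ovs_scale q (ovs_plus x y)) (ovs_plus (ovs_scale q x) (ovs_scale q y))"
      unfolding xy ovs_plus.simps ovs_scale.simps cd prod.case zmult_of_nat
      using xy d by (intro ovs_eqI) (simp_all only: zmult_of_nat, simp_all)
  qed
  obtain s t where st: "quotient_of (p + q) = (s, t)" by force
  obtain s' t' where st': "quotient_of (p * q) = (s', t')" by force
  have t: "t > 0" and t': "t' > 0"
    using st st' by (auto intro: quotient_of_denom_pos)
  have "(of_int s / of_int t :: rat) = of_int a / of_int b + of_int c / of_int d"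
    using quotient_of_div[OF ab] quotient_of_div[OF cd] quotient_of_div[OF st] by simp
  then have "(of_int (s * (b * d)) :: rat) = of_int ((a * d + c * b) * t)"
    using b d t by (simp add: field_simps)
  then have sum: "s * (b * d) = (a * d + c * b) * t"
    unfolding of_int_eq_iff .
  have "(of_int s' / of_int t' :: rat) = of_int a / of_int b * (of_int c / of_int d)"
    using quotient_of_div[OF ab] quotient_of_div[OF cd] quotient_of_div[OF st'] by simp
  then have "(of_int (s' * (b * d)) :: rat) = of_int ((a * c) * t')"
    using b d t' by (simp add: field_simps)
  then have prod: "s' * (b * d) = (a * c) * t'"
    unfolding of_int_eq_iff .
  show "(p + q) *\<^sub>Q u = p *\<^sub>Q u + q *\<^sub>Q u"
  proof (transfer fixing: p q)
    fix x :: "nat \<times> 'a"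
    assume "ovs_eq x x"
    then obtain n w where x: "x = (n, w)" "n > 0" by (cases x) (auto simp: ovs_eq_def)
    have "(b * int n * (d * int n) * s) = int n * int n * (s * (b * d))" by simp
    also have "\<dots> = t * int n * (d * int n * a + b * int n * c)"
      unfolding sum by (simp add: algebra_simps)
    finally have eq: "b * int n * (d * int n) * s = t * int n * (d * int n * a + b * int n * c)" .
    have nat: "int (nat b) = b" "int (nat d) = d" "int (nat t) = t"
      using b d t by simp_all
    have "int (nat b * n * (nat d * n)) \<cdot>\<^sub>Z s \<cdot>\<^sub>Z w =
        int (nat t * n) \<cdot>\<^sub>Z
          (int (nat d * n) \<cdot>\<^sub>Z a \<cdot>\<^sub>Z w + int (nat b * n) \<cdot>\<^sub>Z c \<cdot>\<^sub>Z w)"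
      unfolding zmult_zmult zmult_add_left[symmetric] of_nat_mult nat eq by (rule refl)
    then show "ovs_eq (ovs_scale (p + q) x) (ovs_plus (ovs_scale p x) (ovs_scale q x))"
      unfolding x ovs_plus.simps ovs_scale.simps ab cd st prod.case
      using x b d t by (intro ovs_eqI) (simp_all only: zmult_of_nat, simp_all)
  qed
  show "p *\<^sub>Q q *\<^sub>Q u = (p * q) *\<^sub>Q u"
  proof (transfer fixing: p q)
    fix x :: "nat \<times> 'a"
    assume "ovs_eq x x"
    then obtain n w where x: "x = (n, w)" "n > 0" by (cases x) (auto simp: ovs_eq_def)
    have "t' * int n * (a * c) = int n * (a * c * t')" by simp
    also have "\<dots> = b * (d * int n) * s'"
      unfolding prod[symmetric] by simp
    finally have eq: "t' * int n * (a * c) = b * (d * int n) * s'" .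
    have nat: "int (nat b) = b" "int (nat d) = d" "int (nat t') = t'"
      using b d t' by simp_all
    have "int (nat t' * n) \<cdot>\<^sub>Z a \<cdot>\<^sub>Z c \<cdot>\<^sub>Z w =
        int (nat b * (nat d * n)) \<cdot>\<^sub>Z s' \<cdot>\<^sub>Z w"
      unfolding zmult_zmult of_nat_mult nat using eq by (simp only: mult.assoc)
    then show "ovs_eq (ovs_scale p (ovs_scale q x)) (ovs_scale (p * q) x)"
      unfolding x ovs_scale.simps ab cd st' prod.case
      using x b d t' by (intro ovs_eqI) simp_all
  qed
qed

end

lift_definition to_ovs :: "'g::ordered_ab_group_add \<Rightarrow> 'g ovs" is "\<lambda>u. (1, u)"
  by (auto simp: ovs_eq_def)


section \<open>Archimedean regularization\<close>

definition absolutely_convex :: "'v::ordered_rat_vector set \<Rightarrow> bool" where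
  "absolutely_convex U \<longleftrightarrow>
     (\<forall>u\<in>U. \<forall>v\<in>U. \<forall>p q. p \<ge> 0 \<and> q \<ge> 0 \<and> p + q = 1 \<longrightarrow> p *\<^sub>Q u + q *\<^sub>Q v \<in> U) \<and>
     {v. v \<ge> 0} \<subseteq> U"

definition absorbent :: "'v::ordered_rat_vector set \<Rightarrow> bool" where
  "absorbent U \<longleftrightarrow> (\<forall>v. \<exists>\<mu>>0. \<mu> *\<^sub>Q v \<in> U)"

definition aovs_cone :: "'v::ordered_rat_vector set" where
  "aovs_cone = \<Inter> {U. absolutely_convex U \<and> absorbent U}"

context ordered_rat_vector
begin

lemma scaleQ_zero_right [simp]: "q *\<^sub>Q 0 = 0"
  using scaleQ_add_right[of q 0 0] by simp

lemma scaleQ_zero_left [simp]: "0 *\<^sub>Q x = 0"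
  using scaleQ_add_left[of 0 0 x] by simp

lemma scaleQ_minus_right [simp]: "q *\<^sub>Q (- x) = - (q *\<^sub>Q x)"
  using scaleQ_add_right[of q x "- x"] by (simp add: eq_neg_iff_add_eq_0 add.commute)

lemma scaleQ_diff_right: "q *\<^sub>Q (x - y) = q *\<^sub>Q x - q *\<^sub>Q y"
  using scaleQ_add_right[of q x "- y"] by simp

end

lemma aovs_cone_nonneg: "0 \<le> v \<Longrightarrow> v \<in> aovs_cone"
  unfolding aovs_cone_def absolutely_convex_def by auto

lemma aovs_cone_scale:
  assumes v: "v \<in> aovs_cone" and q: "0 \<le> q"
  shows "q *\<^sub>Q v \<in> aovs_cone"
proof (cases "q = 0")
  case True
  then show ?thesis by (simp add: aovs_cone_nonneg)
next
  case False
  with q have q: "q > 0" by simp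
  show ?thesis
    unfolding aovs_cone_def
  proof (intro InterI, clarify)
    fix U :: "'a set"
    assume U: "absolutely_convex U" "absorbent U"
    have "absolutely_convex {w. q *\<^sub>Q w \<in> U}"
      unfolding absolutely_convex_def
    proof (intro conjI ballI allI impI subsetI)
      fix x y :: 'a and r s :: rat
      assume "x \<in> {w. q *\<^sub>Q w \<in> U}" "y \<in> {w. q *\<^sub>Q w \<in> U}" "0 \<le> r \<and> 0 \<le> s \<and> r + s = 1"
      then have "r *\<^sub>Q q *\<^sub>Q x + s *\<^sub>Q q *\<^sub>Q y \<in> U"
        using U(1) unfolding absolutely_convex_def by auto
      then show "r *\<^sub>Q x + s *\<^sub>Q y \<in> {w. q *\<^sub>Q w \<in> U}"
        by (simp add: scaleQ_add_right scaleQ_scaleQ mult.commute)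
    next
      fix x :: 'a
      assume "x \<in> {v. 0 \<le> v}"
      then have "0 \<le> q *\<^sub>Q x" using scaleQ_left_mono[of 0 x q] q by simp
      then show "x \<in> {w. q *\<^sub>Q w \<in> U}"
        using U(1) unfolding absolutely_convex_def by auto
    qed
    moreover have "absorbent {w. q *\<^sub>Q w \<in> U}"
      unfolding absorbent_def
    proof
      fix x
      obtain \<mu> where "\<mu> > 0" "\<mu> *\<^sub>Q q *\<^sub>Q x \<in> U"
        using U(2) unfolding absorbent_def by blast
      then show "\<exists>\<mu>>0. \<mu> *\<^sub>Q x \<in> {w. q *\<^sub>Q w \<in> U}"
        by (auto simp: scaleQ_scaleQ mult.commute intro!: exI[of _ \<mu>])
    qed
    ultimately show "q *\<^sub>Q v \<in> U"
      using v unfolding aovs_cone_def by blast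
  qed
qed

lemma aovs_cone_add:
  assumes "v \<in> aovs_cone" "w \<in> aovs_cone"
  shows "v + w \<in> aovs_cone"
proof -
  have "(1/2) *\<^sub>Q v + (1/2) *\<^sub>Q w \<in> aovs_cone"
    unfolding aovs_cone_def
  proof (intro InterI, clarify)
    fix U :: "'a set"
    assume U: "absolutely_convex U" "absorbent U"
    then have "v \<in> U" "w \<in> U" using assms unfolding aovs_cone_def by auto
    with U(1) show "(1/2) *\<^sub>Q v + (1/2) *\<^sub>Q w \<in> U"
      unfolding absolutely_convex_def by auto
  qed
  then have "2 *\<^sub>Q ((1/2) *\<^sub>Q v + (1/2) *\<^sub>Q w) \<in> aovs_cone"
    by (rule aovs_cone_scale) simp
  then show ?thesis
    by (simp add: scaleQ_add_right scaleQ_scaleQ scaleQ_one)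
qed

definition aovs_le :: "'v::ordered_rat_vector \<Rightarrow> 'v \<Rightarrow> bool" where
  "aovs_le v u \<longleftrightarrow> u - v \<in> aovs_cone"

lemma aovs_le_refl: "aovs_le u u"
  by (simp add: aovs_le_def aovs_cone_nonneg)

lemma aovs_le_trans: "aovs_le u v \<Longrightarrow> aovs_le v w \<Longrightarrow> aovs_le u w"
  unfolding aovs_le_def using aovs_cone_add[of "w - v" "v - u"] by simp

lemma aovs_le_add: "aovs_le u v \<Longrightarrow> aovs_le u' v' \<Longrightarrow> aovs_le (u + u') (v + v')"
  unfolding aovs_le_def using aovs_cone_add[of "v - u" "v' - u'"] by (simp add: algebra_simps)

lemma aovs_le_minus: "aovs_le u v \<Longrightarrow> aovs_le (- v) (- u)"
  unfolding aovs_le_def by simp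

lemma aovs_le_scale: "aovs_le u v \<Longrightarrow> 0 \<le> q \<Longrightarrow> aovs_le (q *\<^sub>Q u) (q *\<^sub>Q v)"
  unfolding aovs_le_def using aovs_cone_scale[of "v - u" q] by (simp add: scaleQ_diff_right)

definition aovs_eq :: "'v::ordered_rat_vector \<Rightarrow> 'v \<Rightarrow> bool" where
  "aovs_eq u v \<longleftrightarrow> aovs_le u v \<and> aovs_le v u"

lemma aovs_eq_scale:
  assumes "aovs_eq u v"
  shows "aovs_eq (q *\<^sub>Q u) (q *\<^sub>Q v)"
proof (cases "0 \<le> q")
  case True
  then show ?thesis using assms by (simp add: aovs_eq_def aovs_le_scale)
next
  case False
  then have "aovs_eq ((- q) *\<^sub>Q u) ((- q) *\<^sub>Q v)"
    using assms by (simp add: aovs_eq_def aovs_le_scale)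
  moreover have "(- q) *\<^sub>Q x = - (q *\<^sub>Q x)" for x :: 'a
    using scaleQ_add_left[of "- q" q x] by (simp add: eq_neg_iff_add_eq_0)
  ultimately show ?thesis
    using aovs_le_minus[of "- (q *\<^sub>Q u)" "- (q *\<^sub>Q v)"] aovs_le_minus[of "- (q *\<^sub>Q v)" "- (q *\<^sub>Q u)"]
    by (simp add: aovs_eq_def)
qed

lemma equivp_aovs_eq: "equivp aovs_eq"
  by (intro equivpI reflpI sympI transpI)
     (auto simp: aovs_eq_def aovs_le_refl intro: aovs_le_trans)

quotient_type (overloaded) 'v aovs = "'v::ordered_rat_vector" / aovs_eq
  by (rule equivp_aovs_eq)

instantiation aovs :: (ordered_rat_vector) ordered_rat_vector
begin

lift_definition zero_aovs :: "'a aovs" is 0 .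

lift_definition plus_aovs :: "'a aovs \<Rightarrow> 'a aovs \<Rightarrow> 'a aovs" is "(+)"
  unfolding aovs_eq_def by (blast intro: aovs_le_add)

lift_definition uminus_aovs :: "'a aovs \<Rightarrow> 'a aovs" is uminus
  unfolding aovs_eq_def by (blast intro: aovs_le_minus)

definition minus_aovs :: "'a aovs \<Rightarrow> 'a aovs \<Rightarrow> 'a aovs" where
  "minus_aovs u v = u + - v"

lift_definition scaleQ_aovs :: "rat \<Rightarrow> 'a aovs \<Rightarrow> 'a aovs" is "(*\<^sub>Q)"
  by (rule aovs_eq_scale)

lift_definition less_eq_aovs :: "'a aovs \<Rightarrow> 'a aovs \<Rightarrow> bool" is aovs_le
  unfolding aovs_eq_def by (blast intro: aovs_le_trans)

definition less_aovs :: "'a aovs \<Rightarrow> 'a aovs \<Rightarrow> bool" where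
  "less_aovs u v \<longleftrightarrow> u \<le> v \<and> \<not> v \<le> u"

instance
proof
  fix u v w :: "'a aovs" and p q :: rat
  have refl: "aovs_eq x x" for x :: 'a
    by (simp add: aovs_eq_def aovs_le_refl)
  show "u + v + w = u + (v + w)" by transfer (simp add: refl add.assoc)
  show "u + v = v + u" by transfer (simp add: refl add.commute)
  show "0 + u = u" by transfer (simp add: refl)
  show "- u + u = 0" by transfer (simp add: refl)
  show "u - v = u + - v" by (rule minus_aovs_def)
  show "u < v \<longleftrightarrow> u \<le> v \<and> \<not> v \<le> u" by (rule less_aovs_def)
  show "u \<le> u" by transfer (rule aovs_le_refl)
  show "u \<le> v \<Longrightarrow> v \<le> w \<Longrightarrow> u \<le> w" by transfer (rule aovs_le_trans)
  show "u \<le> v \<Longrightarrow> v \<le> u \<Longrightarrow> u = v" by transfer (simp add: aovs_eq_def)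
  show "u \<le> v \<Longrightarrow> w + u \<le> w + v" by transfer (rule aovs_le_add[OF aovs_le_refl])
  show "q *\<^sub>Q (u + v) = q *\<^sub>Q u + q *\<^sub>Q v" by transfer (simp add: refl scaleQ_add_right)
  show "(p + q) *\<^sub>Q u = p *\<^sub>Q u + q *\<^sub>Q u" by transfer (simp add: refl scaleQ_add_left)
  show "p *\<^sub>Q q *\<^sub>Q u = (p * q) *\<^sub>Q u" by transfer (simp add: refl scaleQ_scaleQ)
  show "1 *\<^sub>Q u = u" by transfer (simp add: refl scaleQ_one)
  show "u \<le> v \<Longrightarrow> 0 \<le> q \<Longrightarrow> q *\<^sub>Q u \<le> q *\<^sub>Q v" by transfer (rule aovs_le_scale)
qed

end

lift_definition to_aovs :: "'v::ordered_rat_vector \<Rightarrow> 'v aovs" is "\<lambda>v. v" .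

text \<open>
  For an ordered commutative monoid \<^typ>\<open>'a\<close>, its Archimedean regularization is the type
  \<^typ>\<open>'a oag ovs aovs\<close>, with the following canonical homomorphism.
\<close>

definition aovs_of :: "'a::ordered_comm_monoid_add \<Rightarrow> 'a oag ovs aovs" where
  "aovs_of x = to_aovs (to_ovs (to_oag x))"

end

theory Submission
  imports Defs
begin

text \<open>
  Write $y \preceq x$ if $ny \leq nx + k d$ can be achieved with $n \geq 1$ and $k/n$ arbitrarily
  small; here $d$ is the generator. All six conditions are statements about this one preorder,
  because it has three descriptions:

  \<^item> it is the order of the Archimedean regularization, i.e. $y \preceq x$ iff
    $y \leq x$ there (\<open>aovs_of_le_iff\<close>);
  \<^item> it is the order that all functionals see together, i.e. $y \preceq x$ iff $f(y) \leq f(x)$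
    for every functional $f$ (\<open>regularized_le_iff_functionals\<close>);
  \<^item> it produces rates: if $m y \preceq n x$ for fractions $m/n$ arbitrarily close to $r$, then
    $r$ is a regularized rate from $x$ to $y$ (\<open>regularized_rate_of_regularized_le\<close>).

  The second description is a Hahn--Banach separation. If $y \not\preceq x$, then the positive cone
  of the ordered abelian group of the monoid can be enlarged by a negative multiple of
  $N(x - y) + d$, for some $N$, without containing any $-kd$ with $k \geq 1$. By Zorn's lemma a
  maximal such enlargement exists; it is the cone of a total preorder, in which $d$ is still a
  unit, so measuring elements against multiples of $d$ gives a functional $g$ with $g(x) < g(y)$.

  A functional $f$ \<^emph>\<open>determines the order\<close> if $y \preceq x$ iff $f(y) \leq f(x)$. Such an
  $f$ induces a functional on the regularization that determines its order, and conversely, so its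
  existence means that the regularization is numerical. It forces every functional to be a
  multiple of $f$, since comparing multiples of $x$ and of $d$ fixes the ratio of the values at $x$
  and $d$; conversely, if every functional is a multiple of $f$, then testing with all functionals
  is the same as testing with $f$. Any nonzero functional can take the place of $f$ here.

  For rates, a functional $f$ satisfies $f(x) \geq r f(y)$ whenever $r$ is a finite regularized
  rate from $x$ to $y$, and $f(y) = 0$ if $\infty$ is one. If $f$ determines the order, the bound is
  attained: $R(x \to y) = f(x)/f(y)$ if $f(y) > 0$, so finite opposite rates are reciprocal. The
  condition on the rates between $d$ and $x$ alone is a special case, because a finite rate from
  $d$ to $x$ entails a finite rate back. Finally, if these are reciprocal, then the two bounds for
  the pair $(d, x)$ meet, so the value of a functional at $x$ is a fixed multiple of its value
  at $d$, and all functionals are multiples of one.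
\<close>

section \<open>Multiples and functionals\<close>

lemma functional_mono: "functional f \<Longrightarrow> x \<le> y \<Longrightarrow> f x \<le> f y"
  and functional_add: "functional f \<Longrightarrow> f (x + y) = f x + f y"
  and functional_zero: "functional f \<Longrightarrow> f 0 = 0"
  by (auto simp: functional_def)

lemma functional_nmult: "functional f \<Longrightarrow> f (n \<cdot>\<^sub>N x) = real n * f x"
  by (induction n) (simp_all add: functional_zero functional_add algebra_simps)

lemma functional_minus:
  fixes f :: "'g::ordered_ab_group_add \<Rightarrow> real"
  assumes "functional f"
  shows "f (- x) = - f x"
proof -
  have "f (- x) + f x = f (- x + x)" by (simp only: functional_add[OF assms])
  then show ?thesis using assms by (simp add: functional_zero)
qed

lemma functional_comp:
  assumes "functional g" "\<And>x y. x \<le> y \<Longrightarrow> h x \<le> h y" "\<And>x y. h (x + y) = h x + h y" "h 0 = 0"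
  shows "functional (\<lambda>x. g (h x))"
  using assms by (simp add: functional_def)

lemma additive_nmult:
  fixes h :: "'a::comm_monoid_add \<Rightarrow> 'b::comm_monoid_add"
  assumes "\<And>x y. h (x + y) = h x + h y" "h 0 = 0"
  shows "h (n \<cdot>\<^sub>N x) = n \<cdot>\<^sub>N h x"
  by (induction n) (simp_all add: assms)

lemma nmult_diff: "n \<cdot>\<^sub>N (x - y) = n \<cdot>\<^sub>N x - n \<cdot>\<^sub>N (y :: 'a::ab_group_add)"
  using nmult_add_right[of n x "- y"] by (simp add: nmult_minus)

lemma scaleQ_of_nat: "of_nat n *\<^sub>Q v = n \<cdot>\<^sub>N (v :: 'v::ordered_rat_vector)"
  by (induction n) (simp_all add: scaleQ_add_left scaleQ_one)

lemma nmult_le_cancel: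
  fixes v w :: "'v::ordered_rat_vector"
  assumes "n > 0" "n \<cdot>\<^sub>N v \<le> n \<cdot>\<^sub>N w"
  shows "v \<le> w"
proof -
  have "(1 / of_nat n) *\<^sub>Q n \<cdot>\<^sub>N v \<le> (1 / of_nat n) *\<^sub>Q n \<cdot>\<^sub>N w"
    using assms by (intro scaleQ_left_mono) auto
  then show ?thesis
    using assms by (simp add: scaleQ_scaleQ scaleQ_one flip: scaleQ_of_nat)
qed


section \<open>The canonical homomorphisms\<close>

lemma to_oag_add: "to_oag (x + y) = to_oag x + to_oag y"
  by transfer (simp add: oag_eq_def oag_le_refl)

lemma to_oag_zero: "to_oag 0 = 0"
  by transfer (simp add: oag_eq_def oag_le_refl)

lemmas to_oag_nmult = additive_nmult[of to_oag, OF to_oag_add to_oag_zero]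

lemma to_oag_le_iff: "to_oag x \<le> to_oag y \<longleftrightarrow> (\<exists>z. x + z \<le> y + z)"
  by transfer simp

text \<open>
  The next fact and its analogues below allow every element of a regularization to be
  replaced by elements of the monoid itself.
\<close>

lemma oag_eq_diff: "\<exists>x y. u = to_oag x - to_oag y"
proof -
  have "\<exists>x y. u = to_oag x + - to_oag y"
  proof (transfer, goal_cases)
    case (1 u)
    then show ?case
      by (intro exI[of _ "fst u"] exI[of _ "snd u"]) (simp add: oag_eq_def oag_le_refl)
  qed
  then show ?thesis by simp
qed

lemma to_ovs_add: "to_ovs (u + v) = to_ovs u + to_ovs v"
  by transfer (auto intro!: ovs_eqI)

lemma to_ovs_zero: "to_ovs 0 = 0"
  by transfer (auto intro!: ovs_eqI)

lemmas to_ovs_nmult = additive_nmult[of to_ovs, OF to_ovs_add to_ovs_zero]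

lemma to_ovs_minus: "to_ovs (- u) = - to_ovs u"
  by transfer (auto intro!: ovs_eqI)

lemma to_ovs_le_iff: "to_ovs u \<le> to_ovs v \<longleftrightarrow> (\<exists>j\<ge>1. j \<cdot>\<^sub>N u \<le> j \<cdot>\<^sub>N v)"
  by transfer simp

lemma ovs_eq_fraction: "\<exists>n>0. \<exists>u. n \<cdot>\<^sub>N v = to_ovs u"
proof -
  have "\<exists>n>0. \<exists>u. of_nat n *\<^sub>Q v = to_ovs u"
  proof (transfer, goal_cases)
    case (1 v)
    obtain n u where v: "v = (n, u)" "n > 0"
      using 1 by (cases v) (auto simp: ovs_eq_refl_iff)
    have "quotient_of (of_nat n) = (int n, 1)"
      using quotient_of_int[of "int n"] by simp
    then have "ovs_eq (ovs_scale (of_nat n) v) (1, u)"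
      unfolding v(1) using v(2) by (auto intro!: ovs_eqI)
    then show ?case using v(2) by blast
  qed
  then show ?thesis by (simp add: scaleQ_of_nat)
qed

lemma to_aovs_add: "to_aovs (u + v) = to_aovs u + to_aovs v"
  by transfer (simp add: aovs_eq_def aovs_le_refl)

lemma to_aovs_zero: "to_aovs 0 = 0"
  by transfer (simp add: aovs_eq_def aovs_le_refl)

lemma to_aovs_minus: "to_aovs (- u) = - to_aovs u"
  by transfer (simp add: aovs_eq_def aovs_le_refl)

lemmas to_aovs_nmult = additive_nmult[of to_aovs, OF to_aovs_add to_aovs_zero]

lemma to_aovs_le_iff: "to_aovs u \<le> to_aovs v \<longleftrightarrow> v - u \<in> aovs_cone"
  by transfer (simp add: aovs_le_def)

lemma to_aovs_surj: "\<exists>v. u = to_aovs v"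
  by transfer (auto simp: aovs_eq_def intro: aovs_le_refl)

lemma aovs_of_add: "aovs_of (x + y) = aovs_of x + aovs_of y"
  by (simp add: aovs_of_def to_aovs_add to_ovs_add to_oag_add)

lemma aovs_of_zero: "aovs_of 0 = 0"
  by (simp add: aovs_of_def to_aovs_zero to_ovs_zero to_oag_zero)

lemmas aovs_of_nmult = additive_nmult[of aovs_of, OF aovs_of_add aovs_of_zero]

lemma aovs_of_mono:
  assumes "x \<le> y"
  shows "aovs_of x \<le> aovs_of y"
proof -
  have "to_oag x \<le> to_oag y"
    using assms unfolding to_oag_le_iff by (intro exI[of _ 0]) simp
  then have "to_ovs (to_oag x) \<le> to_ovs (to_oag y)"
    unfolding to_ovs_le_iff by (intro exI[of _ 1]) simp
  then show ?thesis
    unfolding aovs_of_def to_aovs_le_iff by (intro aovs_cone_nonneg) simp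
qed

lemma aovs_eq_fraction: "\<exists>n>0. \<exists>x y. n \<cdot>\<^sub>N u = aovs_of x - aovs_of y"
proof -
  obtain v where v: "u = to_aovs v" using to_aovs_surj by blast
  obtain n w where n: "n > 0" "n \<cdot>\<^sub>N v = to_ovs w" using ovs_eq_fraction by blast
  obtain x y where w: "w = to_oag x + - to_oag y" using oag_eq_diff[of w] by auto
  have "n \<cdot>\<^sub>N u = aovs_of x + - aovs_of y"
    unfolding v to_aovs_nmult[symmetric] n(2) w aovs_of_def
    by (simp only: to_aovs_add to_ovs_add to_aovs_minus to_ovs_minus)
  then show ?thesis using n(1) by auto
qed


section \<open>Separation in ordered abelian groups with order unit\<close>

text \<open>
  These are the positive cones of the preorders extending the given one in which no positive
  multiple of \<open>e\<close> becomes nonpositive. The last condition is imposed on all multiples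
  because a cone need not be closed under division.
\<close>

definition unit_cone :: "'g::ordered_ab_group_add \<Rightarrow> 'g set \<Rightarrow> bool" where
  "unit_cone e C \<longleftrightarrow>
     (\<forall>v\<ge>0. v \<in> C) \<and> (\<forall>v\<in>C. \<forall>w\<in>C. v + w \<in> C) \<and> (\<forall>n>0. - (n \<cdot>\<^sub>N e) \<notin> C)"

lemma unit_cone_nonneg: "unit_cone e C \<Longrightarrow> 0 \<le> v \<Longrightarrow> v \<in> C"
  and unit_cone_add: "unit_cone e C \<Longrightarrow> v \<in> C \<Longrightarrow> w \<in> C \<Longrightarrow> v + w \<in> C"
  and unit_cone_proper: "unit_cone e C \<Longrightarrow> n > 0 \<Longrightarrow> - (n \<cdot>\<^sub>N e) \<notin> C"
  by (auto simp: unit_cone_def)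

lemma unit_cone_nmult: "unit_cone e C \<Longrightarrow> v \<in> C \<Longrightarrow> n \<cdot>\<^sub>N v \<in> C"
  by (induction n) (simp_all add: unit_cone_nonneg unit_cone_add)

lemma unit_cone_zmult: "unit_cone e C \<Longrightarrow> v \<in> C \<Longrightarrow> 0 \<le> k \<Longrightarrow> k \<cdot>\<^sub>Z v \<in> C"
  by (simp add: zmult_def unit_cone_nmult)

definition adjoin :: "'g::ab_group_add set \<Rightarrow> 'g \<Rightarrow> 'g set" where
  "adjoin C v = {c + n \<cdot>\<^sub>N v | c n. c \<in> C}"

lemma subset_adjoin: "C \<subseteq> adjoin C v"
  unfolding adjoin_def by (force intro: exI[of _ "0::nat"])

lemma in_adjoin:
  assumes "0 \<in> C"
  shows "v \<in> adjoin C v"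
proof -
  have "v = 0 + 1 \<cdot>\<^sub>N v" by simp
  then show ?thesis using assms unfolding adjoin_def by blast
qed

lemma unit_cone_adjoin:
  assumes C: "unit_cone e C" and proper: "\<And>k. k > 0 \<Longrightarrow> - (k \<cdot>\<^sub>N e) \<notin> adjoin C v"
  shows "unit_cone e (adjoin C v)"
  unfolding unit_cone_def
proof (intro conjI allI impI ballI)
  show "w \<in> adjoin C v" if "0 \<le> w" for w
    using that subset_adjoin unit_cone_nonneg[OF C] by blast
  fix x y assume "x \<in> adjoin C v" "y \<in> adjoin C v"
  then obtain a m b n where "a \<in> C" "b \<in> C" "x = a + m \<cdot>\<^sub>N v" "y = b + n \<cdot>\<^sub>N v"
    unfolding adjoin_def by blast
  then have "x + y = (a + b) + (m + n) \<cdot>\<^sub>N v" "a + b \<in> C"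
    by (simp_all add: nmult_add_left ac_simps unit_cone_add[OF C])
  then show "x + y \<in> adjoin C v" unfolding adjoin_def by blast
qed (use proper in auto)

text \<open>
  A maximal cone is total: if neither \<open>v\<close> nor \<open>- v\<close> could be adjoined, then both
  \<open>- (k e) = c + n v\<close> and \<open>- (k' e) = c' - n' v\<close> would hold with \<open>c\<close>, \<open>c'\<close> in the cone,
  and eliminating \<open>v\<close> would put a negative multiple of \<open>e\<close> into the cone.
\<close>

lemma total_unit_cone_exists:
  fixes e :: "'g::ordered_ab_group_add"
  assumes "unit_cone e C0"
  obtains C where "C0 \<subseteq> C" "unit_cone e C" "\<And>v. v \<in> C \<or> - v \<in> C"
proof -
  define F where "F = {C. C0 \<subseteq> C \<and> unit_cone e C}"
  have "\<exists>M\<in>F. \<forall>X\<in>F. M \<subseteq> X \<longrightarrow> X = M"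
  proof (rule subset_Zorn_nonempty)
    show "F \<noteq> {}" using assms by (auto simp: F_def)
    fix K assume K: "K \<noteq> {}" "subset.chain F K"
    then have KF: "K \<subseteq> F" and lin: "\<And>X Y. X \<in> K \<Longrightarrow> Y \<in> K \<Longrightarrow> X \<subseteq> Y \<or> Y \<subseteq> X"
      by (auto simp: subset.chain_def)
    have "unit_cone e (\<Union>K)"
      unfolding unit_cone_def
    proof (intro conjI allI impI ballI)
      show "v \<in> \<Union>K" if "0 \<le> v" for v
      proof -
        obtain X where "X \<in> K" using K(1) by blast
        then show ?thesis using KF that unit_cone_nonneg[of e X] by (auto simp: F_def)
      qed
      show "- (n \<cdot>\<^sub>N e) \<notin> \<Union>K" if "n > 0" for n
        using KF that by (auto simp: F_def dest: unit_cone_proper)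
      fix v w assume "v \<in> \<Union>K" "w \<in> \<Union>K"
      then obtain X Y where XY: "X \<in> K" "Y \<in> K" "v \<in> X" "w \<in> Y" by blast
      then obtain Z where "Z \<in> K" "v \<in> Z" "w \<in> Z" using lin[OF XY(1,2)] by blast
      then show "v + w \<in> \<Union>K" using KF by (auto simp: F_def intro: unit_cone_add)
    qed
    then show "\<Union>K \<in> F" using K(1) KF by (auto simp: F_def)
  qed
  then obtain C where CF: "C \<in> F" and max_F: "\<And>X. X \<in> F \<Longrightarrow> C \<subseteq> X \<Longrightarrow> X = C"
    by metis
  then have C: "C0 \<subseteq> C" "unit_cone e C" by (simp_all add: F_def)
  have max: "X = C" if "C \<subseteq> X" "unit_cone e X" for X
    using C(1) that by (intro max_F) (auto simp: F_def)
  have obstruction: "\<exists>k>0. \<exists>c\<in>C. \<exists>n>0. - (k \<cdot>\<^sub>N e) = c + n \<cdot>\<^sub>N v" if "v \<notin> C" for v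
  proof -
    have "adjoin C v \<noteq> C" using that in_adjoin unit_cone_nonneg[OF C(2)] by blast
    then have "\<not> unit_cone e (adjoin C v)" using max subset_adjoin by blast
    then obtain k where "k > 0" "- (k \<cdot>\<^sub>N e) \<in> adjoin C v"
      using unit_cone_adjoin[OF C(2)] by blast
    then obtain c n where "k > 0" "c \<in> C" "- (k \<cdot>\<^sub>N e) = c + n \<cdot>\<^sub>N v"
      unfolding adjoin_def by blast
    moreover have "n > 0"
      using calculation unit_cone_proper[OF C(2), of k] by (cases n) auto
    ultimately show ?thesis by blast
  qed
  have "v \<in> C \<or> - v \<in> C" for v
  proof (rule ccontr)
    assume "\<not> (v \<in> C \<or> - v \<in> C)"
    then obtain k c n k' c' n' where
      1: "k > 0" "c \<in> C" "n > 0" "- (k \<cdot>\<^sub>N e) = c + n \<cdot>\<^sub>N v" and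
      2: "k' > 0" "c' \<in> C" "n' > 0" "- (k' \<cdot>\<^sub>N e) = c' + n' \<cdot>\<^sub>N (- v)"
      using obstruction[of v] obstruction[of "- v"] by blast
    have "- ((n' * k + n * k') \<cdot>\<^sub>N e) = n' \<cdot>\<^sub>N (- (k \<cdot>\<^sub>N e)) + n \<cdot>\<^sub>N (- (k' \<cdot>\<^sub>N e))"
      by (simp add: nmult_add_left nmult_minus nmult_nmult)
    also have "\<dots> = n' \<cdot>\<^sub>N c + n \<cdot>\<^sub>N c'"
      unfolding 1 2 by (simp add: nmult_add_right nmult_diff nmult_minus nmult_nmult mult.commute)
    also have "\<dots> \<in> C"
      using 1 2 by (intro unit_cone_add[OF C(2)] unit_cone_nmult[OF C(2)])
    finally show False using unit_cone_proper[OF C(2), of "n' * k + n * k'"] 1 2 by simp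
  qed
  with C that show thesis by blast
qed

text \<open>
  The value at \<open>v\<close> is the Dedekind cut between the fractions \<open>m / n\<close> with \<open>m e \<le> n v\<close>
  and those with \<open>n v \<le> m e\<close>, in the order given by the cone. The order unit makes both
  classes nonempty, totality makes them exhaust all fractions, and properness of the cone makes
  every lower fraction at most every upper one.
\<close>

lemma functional_of_total_unit_cone:
  fixes e :: "'g::ordered_ab_group_add"
  assumes unit: "\<And>v. \<exists>n. v \<le> n \<cdot>\<^sub>N e"
    and C: "unit_cone e C" and total: "\<And>v. v \<in> C \<or> - v \<in> C"
  obtains g where "functional g" "g e = 1" "\<And>v. v \<in> C \<Longrightarrow> 0 \<le> g v"
proof -
  have proper: "0 \<le> k" if "k \<cdot>\<^sub>Z e \<in> C" for k
  proof (rule ccontr)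
    assume "\<not> 0 \<le> k"
    then show False using that unit_cone_proper[OF C, of "nat (- k)"] by (simp add: zmult_def)
  qed
  define lower where "lower v m n \<longleftrightarrow> n \<cdot>\<^sub>Z v + - (m \<cdot>\<^sub>Z e) \<in> C" for v and m n :: int
  define upper where "upper v m n \<longleftrightarrow> m \<cdot>\<^sub>Z e + - (n \<cdot>\<^sub>Z v) \<in> C" for v and m n :: int
  have lower_or_upper: "lower v m n \<or> upper v m n" for v m n
    using total[of "n \<cdot>\<^sub>Z v + - (m \<cdot>\<^sub>Z e)"] by (simp add: lower_def upper_def)
  \<comment> \<open>Cross-multiplying eliminates v and leaves a multiple of e, whose coefficient is nonnegative.\<close>
  have lower_le_upper: "real_of_int m / real_of_int n \<le> real_of_int m' / real_of_int n'"
    if "n > 0" "n' > 0" "lower v m n" "upper v m' n'" for v m n m' n'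
  proof -
    have "n' \<cdot>\<^sub>Z (n \<cdot>\<^sub>Z v + - (m \<cdot>\<^sub>Z e)) + n \<cdot>\<^sub>Z (m' \<cdot>\<^sub>Z e + - (n' \<cdot>\<^sub>Z v)) \<in> C"
      using unit_cone_add[OF C unit_cone_zmult[OF C that(3)[unfolded lower_def], of n']
          unit_cone_zmult[OF C that(4)[unfolded upper_def], of n]] that(1,2) by simp
    also have "n' \<cdot>\<^sub>Z (n \<cdot>\<^sub>Z v + - (m \<cdot>\<^sub>Z e)) + n \<cdot>\<^sub>Z (m' \<cdot>\<^sub>Z e + - (n' \<cdot>\<^sub>Z v))
        = (n * m' + - (n' * m)) \<cdot>\<^sub>Z e"
    proof -
      have "(- (n' * m)) \<cdot>\<^sub>Z e = - ((n' * m) \<cdot>\<^sub>Z e)"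
        using zmult_add_left[of "- (n' * m)" "n' * m" e]
        by (simp add: zmult_def[of 0] eq_neg_iff_add_eq_0)
      then show ?thesis
        unfolding zmult_add_left[of "n * m'"] zmult_add_right zmult_minus_right zmult_zmult
        by (simp add: mult.commute)
    qed
    finally have "n' * m \<le> n * m'" using proper by fastforce
    then have "real_of_int (n' * m) \<le> real_of_int (n * m')" by (simp only: of_int_le_iff)
    then show ?thesis using that(1,2) by (simp add: field_simps)
  qed
  have "\<exists>r::real. \<forall>m n. n > 0 \<longrightarrow>
      (lower v m n \<longrightarrow> real_of_int m / real_of_int n \<le> r) \<and>
      (upper v m n \<longrightarrow> r \<le> real_of_int m / real_of_int n)" for v
  proof -
    define L where "L = {real_of_int m / real_of_int n | m n. n > 0 \<and> lower v m n}"
    obtain a where "v \<le> a \<cdot>\<^sub>N e" using unit by blast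
    then have a: "upper v (int a) 1"
      unfolding upper_def by (intro unit_cone_nonneg[OF C]) (simp add: zmult_of_nat)
    obtain b where "- v \<le> b \<cdot>\<^sub>N e" using unit by blast
    then have "0 \<le> v + b \<cdot>\<^sub>N e"
      by (metis minus_le_iff add.commute diff_ge_0_iff_ge diff_minus_eq_add)
    then have b: "lower v (- int b) 1"
      unfolding lower_def by (intro unit_cone_nonneg[OF C]) (cases "b = 0"; simp add: zmult_def)
    have "real_of_int (- int b) / real_of_int 1 \<in> L"
      using b unfolding L_def by (intro CollectI exI[of _ "- int b"] exI[of _ 1]) simp
    then have "L \<noteq> {}" by blast
    moreover have "bdd_above L"
      unfolding L_def using lower_le_upper[OF _ _ _ a] by (intro bdd_aboveI) force
    ultimately show ?thesis
      by (intro exI[of _ "Sup L"])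
        (auto intro!: cSup_upper cSup_least simp: L_def intro: lower_le_upper)
  qed
  then obtain g :: "'g \<Rightarrow> real" where
    lower: "\<And>v m n. n > 0 \<Longrightarrow> lower v m n \<Longrightarrow> real_of_int m / real_of_int n \<le> g v" and
    upper: "\<And>v m n. n > 0 \<Longrightarrow> upper v m n \<Longrightarrow> g v \<le> real_of_int m / real_of_int n"
    by metis
  have lower': "lower v m n" if "n > 0" "real_of_int m < real_of_int n * g v" for v m n
    using lower_or_upper[of v m n] upper[of n v m] that by (auto simp: field_simps)
  have upper': "upper v m n" if "n > 0" "real_of_int n * g v < real_of_int m" for v m n
    using lower_or_upper[of v m n] lower[of n v m] that by (auto simp: field_simps)
  have g_add: "g (v + w) = g v + g w" for v w
  proof -
    \<comment> \<open>Rounding n g(v) and n g(w) to integers costs at most 1 each, on either side,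
      so additivity fails by at most 2/n for every n.\<close>
    have bound: "real n * \<bar>g (v + w) - (g v + g w)\<bar> \<le> 2" if "n > 0" for n :: nat
    proof -
      define a b where "a = \<lceil>real n * g v\<rceil> - 1" and "b = \<lceil>real n * g w\<rceil> - 1"
      have ab: "real_of_int a < real n * g v" "real_of_int b < real n * g w"
        "real n * g v - 1 \<le> real_of_int a" "real n * g w - 1 \<le> real_of_int b"
        unfolding a_def b_def by linarith+
      have "lower v a (int n)" "lower w b (int n)" using ab that by (auto intro!: lower')
      then have "(int n \<cdot>\<^sub>Z v + - (a \<cdot>\<^sub>Z e)) + (int n \<cdot>\<^sub>Z w + - (b \<cdot>\<^sub>Z e)) \<in> C"
        unfolding lower_def by (rule unit_cone_add[OF C])
      then have "lower (v + w) (a + b) (int n)"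
        unfolding lower_def zmult_add_left zmult_add_right by (simp add: algebra_simps)
      from lower[OF _ this] that have 1: "real_of_int a + real_of_int b \<le> real n * g (v + w)"
        by (simp add: field_simps)
      define p q where "p = \<lfloor>real n * g v\<rfloor> + 1" and "q = \<lfloor>real n * g w\<rfloor> + 1"
      have pq: "real n * g v < real_of_int p" "real n * g w < real_of_int q"
        "real_of_int p \<le> real n * g v + 1" "real_of_int q \<le> real n * g w + 1"
        unfolding p_def q_def by linarith+
      have "upper v p (int n)" "upper w q (int n)" using pq that by (auto intro!: upper')
      then have "(p \<cdot>\<^sub>Z e + - (int n \<cdot>\<^sub>Z v)) + (q \<cdot>\<^sub>Z e + - (int n \<cdot>\<^sub>Z w)) \<in> C"
        unfolding upper_def by (rule unit_cone_add[OF C])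
      then have "upper (v + w) (p + q) (int n)"
        unfolding upper_def zmult_add_left zmult_add_right by (simp add: algebra_simps)
      from upper[OF _ this] that have 2: "real n * g (v + w) \<le> real_of_int p + real_of_int q"
        by (simp add: field_simps)
      have "\<bar>real n * g (v + w) - (real n * g v + real n * g w)\<bar> \<le> 2"
        using 1 2 ab pq by linarith
      then have "\<bar>real n * (g (v + w) - (g v + g w))\<bar> \<le> 2" by (simp add: algebra_simps)
      then show ?thesis by (simp add: abs_mult)
    qed
    show ?thesis
    proof (rule ccontr)
      assume "g (v + w) \<noteq> g v + g w"
      then have "\<bar>g (v + w) - (g v + g w)\<bar> > 0" by simp
      then obtain n where "2 < real n * \<bar>g (v + w) - (g v + g w)\<bar>"
        using reals_Archimedean3 by blast
      with bound[of n] show False by (cases "n = 0") auto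
    qed
  qed
  have zero: "0 \<in> C" using unit_cone_nonneg[OF C] by simp
  have g_nonneg: "0 \<le> g v" if "v \<in> C" for v
    using lower[of 1 v 0] that by (simp add: lower_def zmult_def)
  have "g e = 1"
    using lower[of 1 e 1] upper[of 1 e 1] zero by (simp add: lower_def upper_def)
  moreover have "functional g"
    unfolding functional_def
  proof (intro conjI allI impI)
    show "g 0 = 0" using g_add[of 0 0] by simp
    fix x y :: 'g assume "x \<ge> y"
    then have "0 \<le> g (x - y)" by (intro g_nonneg unit_cone_nonneg[OF C]) simp
    then show "g x \<ge> g y" using g_add[of "x - y" y] by simp
  qed (rule g_add)
  ultimately show thesis using that g_nonneg by blast
qed

text \<open>
  The negative of \<open>N w + e\<close> can be adjoined to the positive cone, because no positive multiple
  of \<open>N w + e\<close> is nonnegative. The resulting functional is normalised by \<open>g e = 1\<close>, and so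
  \<open>g (N w + e) \<le> 0\<close> makes \<open>g w\<close> strictly negative.
\<close>

lemma separating_functional:
  fixes e w :: "'g::ordered_ab_group_add"
  assumes unit: "\<And>v. \<exists>n. v \<le> n \<cdot>\<^sub>N e"
    and pos: "0 \<le> e"
    and w: "\<And>n. n > 0 \<Longrightarrow> \<not> 0 \<le> n \<cdot>\<^sub>N (N \<cdot>\<^sub>N w + e)"
  obtains g where "functional g" "g w < 0"
proof -
  define u where "u = N \<cdot>\<^sub>N w + e"
  have not_neg: "\<not> 0 \<le> - (n \<cdot>\<^sub>N e)" if "n > 0" for n
  proof
    assume neg: "0 \<le> - (n \<cdot>\<^sub>N e)"
    obtain l where "- u \<le> l \<cdot>\<^sub>N e" using unit by blast
    then have "n \<cdot>\<^sub>N (- u) \<le> n \<cdot>\<^sub>N l \<cdot>\<^sub>N e" by (rule nmult_mono)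
    also have "\<dots> = l \<cdot>\<^sub>N n \<cdot>\<^sub>N e" by (simp add: nmult_nmult mult.commute)
    also have "\<dots> \<le> l \<cdot>\<^sub>N 0" using neg by (intro nmult_mono) simp
    finally have "0 \<le> n \<cdot>\<^sub>N u" by (simp add: nmult_minus)
    then show False using w[OF that] by (simp add: u_def)
  qed
  then have base: "unit_cone e {v. 0 \<le> v}"
    unfolding unit_cone_def by simp
  have "unit_cone e (adjoin {v. 0 \<le> v} (- u))"
  proof (rule unit_cone_adjoin[OF base], rule notI)
    fix k :: nat assume k: "k > 0" and "- (k \<cdot>\<^sub>N e) \<in> adjoin {v. 0 \<le> v} (- u)"
    then obtain p a where p: "0 \<le> p" "- (k \<cdot>\<^sub>N e) = p + a \<cdot>\<^sub>N (- u)"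
      unfolding adjoin_def by blast
    then have eq: "a \<cdot>\<^sub>N u = p + k \<cdot>\<^sub>N e" by (simp add: nmult_minus algebra_simps)
    show False
    proof (cases "a = 0")
      case True
      then show False using p not_neg[OF k] by simp
    next
      case False
      have "0 \<le> k \<cdot>\<^sub>N e" using nmult_mono[OF pos, of k] by simp
      then show False using eq p(1) w[of a] False by (simp add: u_def)
    qed
  qed
  then obtain C where C: "adjoin {v. 0 \<le> v} (- u) \<subseteq> C" "unit_cone e C"
    and total: "\<And>v. v \<in> C \<or> - v \<in> C"
    using total_unit_cone_exists by metis
  obtain g where g: "functional g" "g e = 1" "\<And>v. v \<in> C \<Longrightarrow> 0 \<le> g v"
    using functional_of_total_unit_cone[OF unit C(2) total] by metis
  have "- u \<in> C" using C(1) in_adjoin[of "{v. 0 \<le> v}" "- u"] by auto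
  then have "g u \<le> 0" using g(3)[of "- u"] functional_minus[OF g(1)] by simp
  then have "real N * g w < 0"
    using g(1,2) by (simp add: u_def functional_add functional_nmult)
  then have "g w < 0" by (simp add: mult_less_0_iff)
  with g(1) that show thesis by blast
qed


section \<open>The regularized order of a positive monoid\<close>

text \<open>
  A catalyst \<open>z\<close> can be reused: one copy of it suffices for any number of conversions. In a
  positive monoid its cost, bounded by a multiple of the generator, therefore becomes negligible
  compared with the number of conversions.
\<close>

lemma catalysis_nmult:
  fixes x y z :: "'a::ordered_comm_monoid_add"
  assumes "x + z \<le> y + z"
  shows "n \<cdot>\<^sub>N x + z \<le> n \<cdot>\<^sub>N y + z"
proof (induction n)
  case (Suc n)
  have "Suc n \<cdot>\<^sub>N x + z = x + (n \<cdot>\<^sub>N x + z)" by (simp add: add.assoc)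
  also have "\<dots> \<le> x + (n \<cdot>\<^sub>N y + z)" by (intro add_left_mono Suc.IH)
  also have "\<dots> = n \<cdot>\<^sub>N y + (x + z)" by (simp add: ac_simps)
  also have "\<dots> \<le> n \<cdot>\<^sub>N y + (y + z)" by (intro add_left_mono assms)
  also have "\<dots> = Suc n \<cdot>\<^sub>N y + z" by (simp add: ac_simps)
  finally show ?case .
qed simp

locale generated_positive_monoid =
  fixes d :: "'a::ordered_comm_monoid_add"
  assumes positive: "0 \<le> (x :: 'a)"
    and generator: "generator d"
begin

lemma bounded: obtains n where "x \<le> n \<cdot>\<^sub>N d"
  using generator unfolding generator_def by blast

lemma functional_nonneg: "functional f \<Longrightarrow> 0 \<le> f (x :: 'a)"
  using functional_mono[of f 0 x] positive by (simp add: functional_zero)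

definition regularized_le :: "'a \<Rightarrow> 'a \<Rightarrow> bool"  (infix "\<preceq>" 50) where
  "y \<preceq> x \<longleftrightarrow>
     (\<forall>\<epsilon>::real. \<epsilon> > 0 \<longrightarrow>
        (\<exists>n k. n > 0 \<and> real k \<le> \<epsilon> * real n \<and> n \<cdot>\<^sub>N y \<le> n \<cdot>\<^sub>N x + k \<cdot>\<^sub>N d))"

text \<open>
  Both the passage to the group, which introduces a catalyst, and a fixed surplus \<open>d\<close> on \<open>N\<close>
  copies are absorbed by the vanishing multiples of the generator in \<open>\<preceq>\<close>.
\<close>

lemma regularized_le_of_oag:
  assumes oag: "\<And>N. N > 0 \<Longrightarrow> \<exists>n>0. to_oag (n \<cdot>\<^sub>N N \<cdot>\<^sub>N y) \<le> to_oag (n \<cdot>\<^sub>N (N \<cdot>\<^sub>N x + d))"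
  shows "y \<preceq> x"
  unfolding regularized_le_def
proof (intro allI impI)
  fix \<epsilon> :: real assume \<epsilon>: "\<epsilon> > 0"
  obtain N :: nat where N: "2 / \<epsilon> \<le> real N" using real_arch_simple by blast
  moreover have "0 < 2 / \<epsilon>" using \<epsilon> by simp
  ultimately have N0: "N > 0" by linarith
  obtain n z where n: "n > 0" and z: "n \<cdot>\<^sub>N N \<cdot>\<^sub>N y + z \<le> n \<cdot>\<^sub>N (N \<cdot>\<^sub>N x + d) + z"
    using oag[OF N0] unfolding to_oag_le_iff by blast
  obtain l where l: "z \<le> l \<cdot>\<^sub>N d" using bounded .
  \<comment> \<open>With at least l runs, the catalyst costs no more than the a * n copies of d already spent;
    N was chosen so that 2 * a * n copies are within the tolerance.\<close>
  define a where "a = Suc l"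
  have "(a * n * N) \<cdot>\<^sub>N y = a \<cdot>\<^sub>N n \<cdot>\<^sub>N N \<cdot>\<^sub>N y + 0"
    by (simp only: nmult_nmult mult.assoc add_0_right)
  also have "\<dots> \<le> a \<cdot>\<^sub>N n \<cdot>\<^sub>N N \<cdot>\<^sub>N y + z" by (intro add_left_mono positive)
  also have "\<dots> \<le> a \<cdot>\<^sub>N n \<cdot>\<^sub>N (N \<cdot>\<^sub>N x + d) + z" by (rule catalysis_nmult[OF z])
  also have "\<dots> \<le> a \<cdot>\<^sub>N n \<cdot>\<^sub>N (N \<cdot>\<^sub>N x + d) + l \<cdot>\<^sub>N d" by (intro add_left_mono l)
  also have "\<dots> = (a * n * N) \<cdot>\<^sub>N x + (a * n + l) \<cdot>\<^sub>N d"
    by (simp only: nmult_nmult nmult_add_right nmult_add_left mult.assoc add.assoc)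
  finally have le: "(a * n * N) \<cdot>\<^sub>N y \<le> (a * n * N) \<cdot>\<^sub>N x + (a * n + l) \<cdot>\<^sub>N d" .
  have "l \<le> a * n" using n unfolding a_def by (cases n) auto
  then have "real (a * n + l) \<le> real (a * n) * 2" by linarith
  also have "\<dots> \<le> real (a * n) * (\<epsilon> * real N)"
    using N \<epsilon> by (intro mult_left_mono) (simp_all add: field_simps)
  finally have "real (a * n + l) \<le> \<epsilon> * real (a * n * N)" by (simp add: ac_simps)
  moreover have "a * n * N > 0" using n N0 by (simp add: a_def)
  ultimately show "\<exists>n k. n > 0 \<and> real k \<le> \<epsilon> * real n \<and> n \<cdot>\<^sub>N y \<le> n \<cdot>\<^sub>N x + k \<cdot>\<^sub>N d"
    using le by blast
qed

lemma functional_regularized_le: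
  assumes f: "functional f" and le: "y \<preceq> x"
  shows "f y \<le> f x"
proof (rule field_le_epsilon)
  fix \<eta> :: real assume \<eta>: "\<eta> > 0"
  have d: "0 \<le> f d" by (rule functional_nonneg[OF f])
  define \<epsilon> where "\<epsilon> = \<eta> / (f d + 1)"
  have \<epsilon>: "\<epsilon> > 0" "\<epsilon> * f d \<le> \<eta>" using \<eta> d by (simp_all add: \<epsilon>_def field_simps)
  obtain n k where n: "n > 0" "real k \<le> \<epsilon> * real n" "n \<cdot>\<^sub>N y \<le> n \<cdot>\<^sub>N x + k \<cdot>\<^sub>N d"
    using le \<epsilon>(1) unfolding regularized_le_def by blast
  have "real n * f y \<le> real n * f x + real k * f d"
    using functional_mono[OF f n(3)] by (simp add: functional_add[OF f] functional_nmult[OF f])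
  also have "\<dots> \<le> real n * f x + (\<epsilon> * real n) * f d"
    using n d by (intro add_left_mono mult_right_mono)
  also have "\<dots> = real n * (f x + \<epsilon> * f d)" by (simp add: algebra_simps)
  finally have "f y \<le> f x + \<epsilon> * f d" using n(1) by simp
  then show "f y \<le> f x + \<eta>" using \<epsilon>(2) by simp
qed

lemma to_oag_nonneg: "0 \<le> to_oag (x :: 'a)"
  unfolding to_oag_zero[symmetric] to_oag_le_iff using positive
  by (intro exI[of _ 0]) simp

lemma to_oag_unit: "\<exists>n. u \<le> n \<cdot>\<^sub>N to_oag d"
proof -
  obtain x y where u: "u = to_oag x - to_oag y" using oag_eq_diff by blast
  obtain n where "x \<le> n \<cdot>\<^sub>N d" using bounded .
  then have "to_oag x \<le> n \<cdot>\<^sub>N to_oag d"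
    unfolding to_oag_nmult[symmetric] to_oag_le_iff by (intro exI[of _ 0]) simp
  moreover have "u \<le> to_oag x" unfolding u using to_oag_nonneg by simp
  ultimately show ?thesis using order.trans by blast
qed

text \<open>
  If \<open>y \<preceq> x\<close> fails, then \<open>regularized_le_of_oag\<close> fails for some \<open>N\<close>, and that is exactly
  the hypothesis of \<open>separating_functional\<close> for the difference of \<open>x\<close> and \<open>y\<close>.
\<close>

lemma regularized_le_iff_functionals:
  "y \<preceq> x \<longleftrightarrow> (\<forall>f. functional f \<longrightarrow> f y \<le> f x)"
proof
  assume all: "\<forall>f. functional f \<longrightarrow> f y \<le> f x"
  show "y \<preceq> x"
  proof (rule regularized_le_of_oag, rule ccontr)
    fix N :: nat
    assume none: "\<not> (\<exists>n>0. to_oag (n \<cdot>\<^sub>N N \<cdot>\<^sub>N y) \<le> to_oag (n \<cdot>\<^sub>N (N \<cdot>\<^sub>N x + d)))"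
    have "0 \<le> n \<cdot>\<^sub>N (N \<cdot>\<^sub>N (to_oag x - to_oag y) + to_oag d) \<longleftrightarrow>
        to_oag (n \<cdot>\<^sub>N N \<cdot>\<^sub>N y) \<le> to_oag (n \<cdot>\<^sub>N (N \<cdot>\<^sub>N x + d))" for n
      by (simp add: to_oag_nmult to_oag_add nmult_diff nmult_add_right algebra_simps)
    with none have "\<not> 0 \<le> n \<cdot>\<^sub>N (N \<cdot>\<^sub>N (to_oag x - to_oag y) + to_oag d)" if "n > 0" for n
      using that by blast
    then obtain g where g: "functional g" "g (to_oag x - to_oag y) < 0"
      using separating_functional[OF to_oag_unit to_oag_nonneg] by metis
    have "functional (\<lambda>x. g (to_oag x))"
    proof (rule functional_comp[OF g(1)])
      show "to_oag a \<le> to_oag b" if "a \<le> b" for a b :: 'a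
        using that unfolding to_oag_le_iff by (intro exI[of _ 0]) simp
    qed (simp_all add: to_oag_add to_oag_zero)
    with all have "(\<lambda>x. g (to_oag x)) y \<le> (\<lambda>x. g (to_oag x)) x" by blast
    moreover have "g (to_oag x - to_oag y) = g (to_oag x) - g (to_oag y)"
      using functional_add[OF g(1), of "to_oag x - to_oag y" "to_oag y"] by simp
    ultimately show False using g(2) by simp
  qed
qed (use functional_regularized_le in blast)

text \<open>
  The set on the right is itself absolutely convex and absorbent, the latter because the
  generator is an order unit.
\<close>

lemma aovs_cone_subset: "aovs_cone \<subseteq> {v. 0 \<le> v + q *\<^sub>Q to_ovs (to_oag d)}" if q: "q > 0"
proof -
  let ?e = "to_ovs (to_oag d)" and ?U = "{v. 0 \<le> v + q *\<^sub>Q to_ovs (to_oag d)}"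
  have e: "0 \<le> ?e"
    unfolding to_ovs_zero[symmetric] to_ovs_le_iff using to_oag_nonneg
    by (intro exI[of _ 1]) simp
  have "absolutely_convex ?U"
    unfolding absolutely_convex_def
  proof (intro conjI ballI allI impI subsetI)
    fix u v and r s :: rat
    assume uv: "u \<in> ?U" "v \<in> ?U" and rs: "0 \<le> r \<and> 0 \<le> s \<and> r + s = 1"
    have "r *\<^sub>Q 0 + s *\<^sub>Q 0 \<le> r *\<^sub>Q (u + q *\<^sub>Q ?e) + s *\<^sub>Q (v + q *\<^sub>Q ?e)"
      using uv rs by (intro add_mono scaleQ_left_mono) auto
    also have "\<dots> = r *\<^sub>Q u + s *\<^sub>Q v + ((r + s) * q) *\<^sub>Q ?e"
      by (simp add: scaleQ_add_left scaleQ_add_right scaleQ_scaleQ algebra_simps)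
    finally show "r *\<^sub>Q u + s *\<^sub>Q v \<in> ?U" using rs by simp
  next
    fix v :: "'a oag ovs" assume "v \<in> {v. 0 \<le> v}"
    then show "v \<in> ?U" using scaleQ_left_mono[OF e, of q] q by simp
  qed
  moreover have "absorbent ?U"
    unfolding absorbent_def
  proof
    fix v :: "'a oag ovs"
    obtain n u where n: "n > 0" "n \<cdot>\<^sub>N v = to_ovs u" using ovs_eq_fraction by blast
    obtain m where m: "- u \<le> m \<cdot>\<^sub>N to_oag d" using to_oag_unit by blast
    also have "\<dots> \<le> Suc m \<cdot>\<^sub>N to_oag d" using to_oag_nonneg by simp
    finally have "to_ovs (- u) \<le> to_ovs (Suc m \<cdot>\<^sub>N to_oag d)"
      unfolding to_ovs_le_iff by (intro exI[of _ 1]) simp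
    then have "to_ovs u + - to_ovs u \<le> n \<cdot>\<^sub>N v + Suc m \<cdot>\<^sub>N ?e"
      unfolding n(2) to_ovs_nmult to_ovs_minus by (rule add_left_mono)
    then have "0 \<le> n \<cdot>\<^sub>N v + Suc m \<cdot>\<^sub>N ?e" by simp
    then have "0 \<le> of_nat n *\<^sub>Q v + of_nat (Suc m) *\<^sub>Q ?e" by (simp only: scaleQ_of_nat)
    from scaleQ_left_mono[OF this, of "q / of_nat (Suc m)"] q
    have "0 \<le> (q / of_nat (Suc m) * of_nat n) *\<^sub>Q v + (q / of_nat (Suc m) * of_nat (Suc m)) *\<^sub>Q ?e"
      by (simp only: scaleQ_add_right scaleQ_scaleQ scaleQ_zero_right zero_le_divide_iff
          of_nat_0_le_iff less_imp_le simp_thms)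
    moreover have "q / of_nat (Suc m) * of_nat (Suc m) = q"
      by (simp del: of_nat_Suc)
    ultimately have "0 \<le> (q / of_nat (Suc m) * of_nat n) *\<^sub>Q v + q *\<^sub>Q ?e" by simp
    moreover have "q / of_nat (Suc m) * of_nat n > 0"
      using q n(1) by (intro mult_pos_pos divide_pos_pos) (simp_all del: of_nat_Suc)
    ultimately show "\<exists>\<mu>>0. \<mu> *\<^sub>Q v \<in> ?U" by blast
  qed
  ultimately show ?thesis unfolding aovs_cone_def by blast
qed

text \<open>
  Membership of \<open>x - y\<close> in the translates of the positive cone by small multiples of \<open>d\<close> gives
  \<open>y \<preceq> x\<close>. Conversely, an absorbent set \<open>U\<close> contains some \<open>- \<mu> d\<close>, and \<open>y \<preceq> x\<close> makes
  \<open>2 (x - y) + \<mu> d\<close> nonnegative, so \<open>x - y\<close> is the midpoint of two elements of \<open>U\<close>.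
\<close>

lemma aovs_of_le_iff: "aovs_of y \<le> aovs_of x \<longleftrightarrow> y \<preceq> x"
proof
  let ?e = "to_ovs (to_oag d)" and ?v = "to_ovs (to_oag x) - to_ovs (to_oag y)"
  assume "aovs_of y \<le> aovs_of x"
  then have v: "?v \<in> aovs_cone" by (simp add: aovs_of_def to_aovs_le_iff)
  show "y \<preceq> x"
  proof (rule regularized_le_of_oag)
    fix N :: nat assume N: "N > 0"
    have "0 \<le> ?v + (1 / of_nat N) *\<^sub>Q ?e" using v aovs_cone_subset[of "1 / of_nat N"] N by auto
    then have "of_nat N *\<^sub>Q 0 \<le> of_nat N *\<^sub>Q (?v + (1 / of_nat N) *\<^sub>Q ?e)"
      by (intro scaleQ_left_mono) auto
    also have "\<dots> = N \<cdot>\<^sub>N ?v + ?e"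
      using N by (simp add: scaleQ_add_right scaleQ_scaleQ scaleQ_of_nat scaleQ_one)
    finally have "to_ovs (to_oag (N \<cdot>\<^sub>N y)) \<le> to_ovs (to_oag (N \<cdot>\<^sub>N x + d))"
      by (simp add: to_ovs_add to_ovs_nmult to_oag_add to_oag_nmult nmult_diff algebra_simps)
    then show "\<exists>n>0. to_oag (n \<cdot>\<^sub>N N \<cdot>\<^sub>N y) \<le> to_oag (n \<cdot>\<^sub>N (N \<cdot>\<^sub>N x + d))"
      unfolding to_ovs_le_iff by (auto simp: to_oag_nmult Suc_le_eq)
  qed
next
  let ?e = "to_ovs (to_oag d)" and ?v = "to_ovs (to_oag x) - to_ovs (to_oag y)"
  assume le: "y \<preceq> x"
  have e: "0 \<le> ?e"
    unfolding to_ovs_zero[symmetric] to_ovs_le_iff using to_oag_nonneg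
    by (intro exI[of _ 1]) simp
  have "?v \<in> aovs_cone"
    unfolding aovs_cone_def
  proof (intro InterI, clarify)
    fix U :: "'a oag ovs set" assume U: "absolutely_convex U" "absorbent U"
    then obtain \<mu> where \<mu>: "\<mu> > 0" "\<mu> *\<^sub>Q (- ?e) \<in> U" unfolding absorbent_def by blast
    obtain n k where n: "n > 0" "real k \<le> real_of_rat (\<mu> / 2) * real n"
        "n \<cdot>\<^sub>N y \<le> n \<cdot>\<^sub>N x + k \<cdot>\<^sub>N d"
      using le \<mu>(1) unfolding regularized_le_def by (metis half_gt_zero zero_less_of_rat_iff)
    have "real_of_rat (of_nat k) \<le> real_of_rat (\<mu> / 2 * of_nat n)"
      using n(2) by (simp add: of_rat_mult of_rat_divide)
    then have k: "of_nat k \<le> \<mu> / 2 * of_nat n" unfolding of_rat_less_eq .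
    have "to_oag (n \<cdot>\<^sub>N y) \<le> to_oag (n \<cdot>\<^sub>N x + k \<cdot>\<^sub>N d)"
      using n(3) unfolding to_oag_le_iff by (intro exI[of _ 0]) simp
    then have "to_ovs (to_oag (n \<cdot>\<^sub>N y)) \<le> to_ovs (to_oag (n \<cdot>\<^sub>N x + k \<cdot>\<^sub>N d))"
      unfolding to_ovs_le_iff by (intro exI[of _ 1]) simp
    then have "0 \<le> n \<cdot>\<^sub>N ?v + k \<cdot>\<^sub>N ?e"
      by (simp add: to_ovs_add to_ovs_nmult to_oag_add to_oag_nmult nmult_diff algebra_simps)
    also have "\<dots> \<le> of_nat n *\<^sub>Q ?v + (\<mu> / 2 * of_nat n) *\<^sub>Q ?e"
    proof -
      have "0 \<le> (\<mu> / 2 * of_nat n - of_nat k) *\<^sub>Q ?e"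
        using scaleQ_left_mono[OF e, of "\<mu> / 2 * of_nat n - of_nat k"] k by simp
      then have "of_nat k *\<^sub>Q ?e \<le> of_nat k *\<^sub>Q ?e + (\<mu> / 2 * of_nat n - of_nat k) *\<^sub>Q ?e" by simp
      then show ?thesis unfolding scaleQ_add_left[symmetric] by (simp add: scaleQ_of_nat)
    qed
    finally have "(2 / of_nat n) *\<^sub>Q 0 \<le> (2 / of_nat n) *\<^sub>Q (of_nat n *\<^sub>Q ?v + (\<mu> / 2 * of_nat n) *\<^sub>Q ?e)"
      by (intro scaleQ_left_mono) auto
    then have "2 *\<^sub>Q ?v + \<mu> *\<^sub>Q ?e \<in> U"
      using U(1) n(1) by (auto simp: absolutely_convex_def scaleQ_add_right scaleQ_scaleQ)
    then have "(1/2) *\<^sub>Q (2 *\<^sub>Q ?v + \<mu> *\<^sub>Q ?e) + (1/2) *\<^sub>Q \<mu> *\<^sub>Q (- ?e) \<in> U"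
      using U(1) \<mu>(2) unfolding absolutely_convex_def by auto
    then show "?v \<in> U"
      by (simp only: scaleQ_add_right scaleQ_scaleQ scaleQ_minus_right) (simp add: scaleQ_one)
  qed
  then show "aovs_of y \<le> aovs_of x" by (simp add: aovs_of_def to_aovs_le_iff)
qed


section \<open>Regularized rates and functionals\<close>

lemma ennreal_fraction: "n > 0 \<Longrightarrow> (of_nat m / of_nat n :: ennreal) = ennreal (real m / real n)"
  by (simp add: divide_ennreal ennreal_of_nat_eq_real_of_nat)

text \<open>
  Apply the functional to \<open>m y \<le> n x + k d\<close> and divide by \<open>n\<close>. As \<open>m / n\<close> stays bounded
  near \<open>t\<close>, the number \<open>k\<close> is small compared with \<open>n\<close>.
\<close>

lemma regularized_rate_functional:
  assumes f: "functional f" and rate: "regularized_rate d x y (ennreal t)" and t: "0 \<le> t"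
  shows "t * f y \<le> f x"
proof (cases "t = 0")
  case True
  then show ?thesis using functional_nonneg[OF f] by simp
next
  case False
  with t have t: "t > 0" by simp
  have d: "0 \<le> f d" and y: "0 \<le> f y" by (simp_all add: functional_nonneg[OF f])
  show ?thesis
  proof (rule field_le_epsilon)
    fix \<eta> :: real assume \<eta>: "\<eta> > 0"
    \<comment> \<open>The error splits into one half from m/n differing from t and one half from the term k * d,
      where max m n is at most (t + 2) * n.\<close>
    define \<delta> where "\<delta> = \<eta> / (2 * (f y + 1))"
    define \<epsilon> where "\<epsilon> = \<eta> / (2 * (f d + 1)) / (t + 2)"
    have \<delta>: "\<delta> > 0" "\<delta> * f y \<le> \<eta> / 2" using \<eta> y by (simp_all add: \<delta>_def field_simps)
    have "\<epsilon> * (t + 2) = \<eta> / (2 * (f d + 1))" using t by (simp add: \<epsilon>_def)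
    then have "\<epsilon> * (t + 2) * f d = \<eta> / (2 * (f d + 1)) * f d" by (simp only:)
    also have "\<dots> \<le> \<eta> / 2" using \<eta> d by (simp add: field_simps)
    finally have \<epsilon>: "\<epsilon> > 0" "\<epsilon> * (t + 2) * f d \<le> \<eta> / 2"
      using \<eta> d t by (simp_all add: \<epsilon>_def)
    have U: "open {ennreal (t - \<delta>)<..<ennreal (t + 1)}" "ennreal t \<in> {ennreal (t - \<delta>)<..<ennreal (t + 1)}"
      using t \<delta> by (auto intro: ennreal_lessI)
    then obtain m n k where U: "(of_nat m / of_nat n :: ennreal) \<in> {ennreal (t - \<delta>)<..<ennreal (t + 1)}"
      and mn: "m \<noteq> 0 \<or> n \<noteq> 0" and k: "real k \<le> \<epsilon> * real (max m n)"
      and le: "m \<cdot>\<^sub>N y \<le> n \<cdot>\<^sub>N x + k \<cdot>\<^sub>N d"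
      using rate[unfolded regularized_rate_def, rule_format, OF \<epsilon>(1) conjI[OF U]] by blast
    have n: "n > 0"
    proof (rule ccontr)
      assume "\<not> n > 0"
      then have "(of_nat m / of_nat n :: ennreal) = \<infinity>" using mn by (simp add: ennreal_divide_zero)
      then show False using U by simp
    qed
    have lo: "t - \<delta> < real m / real n" and hi: "real m / real n < t + 1"
      using U t unfolding ennreal_fraction[OF n]
      by (auto simp: ennreal_less_iff intro: ccontr dest!: leI ennreal_leI)
    have "real (max m n) \<le> real n * (t + 2)"
      using hi n t by (auto simp: field_simps max_def)
    then have "\<epsilon> * real (max m n) \<le> \<epsilon> * (real n * (t + 2))" using \<epsilon>(1) by (intro mult_left_mono) auto
    with k have k': "real k \<le> \<epsilon> * (real n * (t + 2))" by linarith
    have "real m * f y \<le> real n * f x + real k * f d"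
      using functional_mono[OF f le] by (simp add: functional_add[OF f] functional_nmult[OF f])
    also have "\<dots> \<le> real n * f x + \<epsilon> * (real n * (t + 2)) * f d"
      using k' d by (intro add_left_mono mult_right_mono)
    also have "\<dots> = real n * (f x + \<epsilon> * (t + 2) * f d)" by (simp add: algebra_simps)
    finally have "real m / real n * f y \<le> f x + \<epsilon> * (t + 2) * f d" using n by (simp add: field_simps)
    moreover have "(t - \<delta>) * f y \<le> real m / real n * f y" using lo y by (intro mult_right_mono) auto
    moreover have "(t - \<delta>) * f y = t * f y - \<delta> * f y" by (simp add: left_diff_distrib)
    ultimately show "t * f y \<le> f x + \<eta>" using \<delta>(2) \<epsilon>(2) by linarith
  qed
qed

text \<open>
  For fractions close to \<open>\<infinity>\<close> it is \<open>m\<close> that dominates, so one divides by \<open>m\<close> instead: both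
  \<open>n / m\<close> and \<open>k / m\<close> tend to zero.
\<close>

lemma infinite_regularized_rate_functional:
  assumes f: "functional f" and rate: "regularized_rate d x y \<infinity>"
  shows "f y = 0"
proof (rule ccontr)
  assume "f y \<noteq> 0"
  then have y: "f y > 0" using functional_nonneg[OF f, of y] by simp
  have d: "0 \<le> f d" and x: "0 \<le> f x" by (simp_all add: functional_nonneg[OF f])
  \<comment> \<open>Chosen so that the contributions of x and of d each amount to at most a quarter of f y
    after division by m.\<close>
  define K where "K = max 1 (4 * f x / f y)"
  define \<epsilon> where "\<epsilon> = f y / (4 * (f d + 1))"
  have K: "K \<ge> 1" "4 * f x \<le> f y * K" using y by (auto simp: K_def max_def field_simps)
  have \<epsilon>: "\<epsilon> > 0" "4 * (\<epsilon> * f d) \<le> f y" using y d by (simp_all add: \<epsilon>_def field_simps)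
  have U: "open {ennreal K<..}" "\<infinity> \<in> {ennreal K<..}" by auto
  then obtain m n k where U: "(of_nat m / of_nat n :: ennreal) \<in> {ennreal K<..}"
    and mn: "m \<noteq> 0 \<or> n \<noteq> 0" and k: "real k \<le> \<epsilon> * real (max m n)"
    and le: "m \<cdot>\<^sub>N y \<le> n \<cdot>\<^sub>N x + k \<cdot>\<^sub>N d"
    using rate[unfolded regularized_rate_def, rule_format, OF \<epsilon>(1) conjI[OF U]] by blast
  have nm: "real n * K \<le> real m"
  proof (cases "n > 0")
    case True
    then have "K < real m / real n" using U K(1) unfolding ennreal_fraction[OF True] by (auto simp: ennreal_less_iff)
    then show ?thesis using True by (simp add: field_simps)
  qed simp
  moreover have "real n \<le> real n * K" using K(1) by (simp add: mult_le_cancel_left1)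
  ultimately have "n \<le> m" by linarith
  then have max: "max m n = m" and m: "m > 0" using mn by auto
  have "real m * f y \<le> real n * f x + real k * f d"
    using functional_mono[OF f le] by (simp add: functional_add[OF f] functional_nmult[OF f])
  also have "\<dots> \<le> real n * f x + \<epsilon> * real m * f d"
    using k d unfolding max by (intro add_left_mono mult_right_mono)
  finally have "4 * (real m * f y) \<le> real n * (4 * f x) + real m * (4 * (\<epsilon> * f d))" by (simp add: algebra_simps)
  also have "\<dots> \<le> real n * (f y * K) + real m * f y"
    using K(2) \<epsilon>(2) by (intro add_mono mult_left_mono) auto
  also have "real n * (f y * K) = real n * K * f y" by simp
  also have "\<dots> \<le> real m * f y" using nm y by (intro mult_right_mono) auto
  finally show False using m y by simp
qed

lemma regularized_rate_of_regularized_le: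
  assumes "\<And>U. open U \<Longrightarrow> r \<in> U \<Longrightarrow>
    \<exists>m n. (m \<noteq> 0 \<or> n \<noteq> 0) \<and> of_nat m / of_nat n \<in> U \<and> m \<cdot>\<^sub>N y \<preceq> n \<cdot>\<^sub>N x"
  shows "regularized_rate d x y r"
  unfolding regularized_rate_def
proof (intro allI impI)
  fix \<epsilon> :: real and U :: "ennreal set" assume \<epsilon>: "\<epsilon> > 0" and U: "open U \<and> r \<in> U"
  obtain m n where mn: "m \<noteq> 0 \<or> n \<noteq> 0" "of_nat m / of_nat n \<in> U" "m \<cdot>\<^sub>N y \<preceq> n \<cdot>\<^sub>N x"
    using assms U by blast
  obtain N k where N: "N > 0" "real k \<le> \<epsilon> * real N" "N \<cdot>\<^sub>N m \<cdot>\<^sub>N y \<le> N \<cdot>\<^sub>N n \<cdot>\<^sub>N x + k \<cdot>\<^sub>N d"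
    using mn(3) \<epsilon> unfolding regularized_le_def by blast
  have "(of_nat (N * m) / of_nat (N * n) :: ennreal) = of_nat m / of_nat n"
  proof (cases "n = 0")
    case True
    then show ?thesis using mn(1) N(1) by (simp add: ennreal_divide_zero)
  next
    case False
    then show ?thesis using N(1) by (simp add: ennreal_fraction del: of_nat_mult) simp
  qed
  moreover have "N \<le> max (N * m) (N * n)" using mn(1) by (auto simp: le_max_iff_disj)
  then have "\<epsilon> * real N \<le> \<epsilon> * real (max (N * m) (N * n))"
    using \<epsilon> by (intro mult_left_mono) simp_all
  then have "real k \<le> \<epsilon> * real (max (N * m) (N * n))" using N(2) by linarith
  ultimately show "\<exists>m n k. (m \<noteq> 0 \<or> n \<noteq> 0) \<and> of_nat m / of_nat n \<in> U \<and>
      real k \<le> \<epsilon> * real (max m n) \<and> m \<cdot>\<^sub>N y \<le> n \<cdot>\<^sub>N x + k \<cdot>\<^sub>N d"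
    using mn(1,2) N(1,3)
    by (intro exI[of _ "N * m"] exI[of _ "N * n"] exI[of _ k]) (auto simp: nmult_nmult simp del: of_nat_mult)
qed

lemmas rate_Rmax = regularized_rate_Rmax_reg[OF positive]
  and Rmax_upper = regularized_rate_le_Rmax_reg[OF positive]

lemma Rmax_functional:
  assumes "functional f" "Rmax_reg d x y < \<infinity>"
  shows "enn2real (Rmax_reg d x y) * f y \<le> f x"
  using assms rate_Rmax[of d x y]
  by (intro regularized_rate_functional) (auto simp: ennreal_enn2real_if)

text \<open>
  If all functionals vanish at \<open>y\<close>, then \<open>y \<preceq> 0\<close>, so the fraction \<open>1/0\<close> is attained.
\<close>

lemma Rmax_infinite_iff: "Rmax_reg d x y = \<infinity> \<longleftrightarrow> (\<forall>f. functional f \<longrightarrow> f y = 0)"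
proof
  assume "Rmax_reg d x y = \<infinity>"
  then show "\<forall>f. functional f \<longrightarrow> f y = 0"
    using rate_Rmax[of d x y] by (auto intro: infinite_regularized_rate_functional)
next
  assume zero: "\<forall>f. functional f \<longrightarrow> f y = 0"
  then have "1 \<cdot>\<^sub>N y \<preceq> 0 \<cdot>\<^sub>N x"
    unfolding regularized_le_iff_functionals
    by (metis add_0_right functional_zero nmult.simps order_refl One_nat_def)
  then have "regularized_rate d x y \<infinity>"
    by (intro regularized_rate_of_regularized_le exI[of _ "1::nat"] exI[of _ "0::nat"])
      (auto simp: ennreal_divide_zero)
  then show "Rmax_reg d x y = \<infinity>" using Rmax_upper[of d x y \<infinity>] by (simp add: top_unique)
qed


section \<open>Numerical regularization\<close>

text \<open>
  By \<open>aovs_of_le_iff\<close> such a functional represents the order of the Archimedean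
  regularization restricted to the monoid.
\<close>

definition order_determined_by :: "('a \<Rightarrow> real) \<Rightarrow> bool" where
  "order_determined_by f \<longleftrightarrow> functional f \<and> (\<forall>x y. x \<preceq> y \<longleftrightarrow> f x \<le> f y)"

text \<open>
  The upper bound holds for every functional. For the lower bound, any fraction \<open>m / n\<close> below
  \<open>f x / f y\<close> satisfies \<open>f (m y) \<le> f (n x)\<close>, hence \<open>m y \<preceq> n x\<close>.
\<close>

lemma Rmax_numerical:
  assumes f: "order_determined_by f" and y: "f y > 0"
  shows "Rmax_reg d x y = ennreal (f x / f y)"
proof (rule order.antisym)
  have func: "functional f" and le: "\<And>x y. x \<preceq> y \<longleftrightarrow> f x \<le> f y"
    using f by (auto simp: order_determined_by_def)
  have x: "0 \<le> f x" by (rule functional_nonneg[OF func])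
  have "Rmax_reg d x y \<noteq> \<infinity>" using y func unfolding Rmax_infinite_iff by auto
  then have fin: "Rmax_reg d x y < \<infinity>" by (simp add: less_top)
  have "enn2real (Rmax_reg d x y) \<le> f x / f y"
    using Rmax_functional[OF func fin] y by (simp add: field_simps)
  then have "ennreal (enn2real (Rmax_reg d x y)) \<le> ennreal (f x / f y)" by (rule ennreal_leI)
  then show "Rmax_reg d x y \<le> ennreal (f x / f y)" using fin by simp
  show "ennreal (f x / f y) \<le> Rmax_reg d x y"
  proof (rule Rmax_upper, rule regularized_rate_of_regularized_le)
    fix U :: "ennreal set" assume U: "open U" "ennreal (f x / f y) \<in> U"
    show "\<exists>m n. (m \<noteq> 0 \<or> n \<noteq> 0) \<and> of_nat m / of_nat n \<in> U \<and> m \<cdot>\<^sub>N y \<preceq> n \<cdot>\<^sub>N x"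
    proof (cases "f x = 0")
      case True
      then show ?thesis
        using U(2) by (intro exI[of _ "0::nat"] exI[of _ "1::nat"]) (simp add: le functional_zero[OF func])
    next
      case False
      have "open (ennreal -` U)"
        using U(1) by (rule open_vimage) (rule continuous_on_ennreal, rule continuous_on_id)
      then obtain e where e: "e > 0" "\<And>s. \<bar>s - f x / f y\<bar> < e \<Longrightarrow> ennreal s \<in> U"
        using U(2) unfolding open_dist dist_real_def by auto
      \<comment> \<open>The lower cutoff 0 makes the approximating rational a quotient of natural numbers.\<close>
      have "max 0 (f x / f y - e) < f x / f y" using False x y e(1) by simp
      then obtain s where s: "s \<in> \<rat>" "max 0 (f x / f y - e) < s" "s < f x / f y"
        using Rats_dense_in_real by blast
      obtain m n :: nat where mn: "n \<noteq> 0" "\<bar>s\<bar> = real m / real n" by (rule Rats_abs_nat_div_natE[OF s(1)])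
      have s_eq: "s = real m / real n" using mn(2) s(2) by simp
      have "ennreal s \<in> U" using s by (intro e(2)) auto
      then have "of_nat m / of_nat n \<in> U" using mn(1) by (simp add: s_eq ennreal_fraction)
      moreover have "m \<cdot>\<^sub>N y \<preceq> n \<cdot>\<^sub>N x"
        using s(3) y mn(1) by (simp add: le functional_nmult[OF func] s_eq field_simps)
      ultimately show ?thesis using mn(1) by blast
    qed
  qed
qed


text \<open>
  Every element of the regularization is a fraction of a difference of monoid elements, so clearing
  denominators reduces comparisons there to comparisons in the monoid. This makes the evident
  extension of \<open>f\<close> well defined and shows that it reflects the order.
\<close>

lemma numerical_iff: "numerical TYPE('a oag ovs aovs) \<longleftrightarrow> (\<exists>f. order_determined_by f)"
proof
  assume "numerical TYPE('a oag ovs aovs)"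
  then obtain h :: "'a oag ovs aovs \<Rightarrow> real" where h: "functional h" "\<And>u v. u \<ge> v \<longleftrightarrow> h u \<ge> h v"
    unfolding numerical_def by blast
  have "functional (\<lambda>x. h (aovs_of x))"
    using h(1) by (rule functional_comp) (simp_all add: aovs_of_mono aovs_of_add aovs_of_zero)
  moreover have "x \<preceq> y \<longleftrightarrow> h (aovs_of x) \<le> h (aovs_of y)" for x y
    unfolding h(2)[symmetric] aovs_of_le_iff by (rule refl)
  ultimately show "\<exists>f. order_determined_by f" unfolding order_determined_by_def by blast
next
  assume "\<exists>f. order_determined_by f"
  then obtain f where f: "functional f" and le: "\<And>x y. x \<preceq> y \<longleftrightarrow> f x \<le> f y"
    unfolding order_determined_by_def by blast
  have "\<forall>u. \<exists>n x y. n > 0 \<and> n \<cdot>\<^sub>N u = aovs_of x - aovs_of y"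
    using aovs_eq_fraction by blast
  then obtain N X Y where rep: "\<And>u :: 'a oag ovs aovs. N u > 0 \<and> N u \<cdot>\<^sub>N u = aovs_of (X u) - aovs_of (Y u)"
    by metis
  define h where "h u = (f (X u) - f (Y u)) / real (N u)" for u
  \<comment> \<open>The same equivalence yields both that h determines the order and, by antisymmetry of
    the reals, that h does not depend on the chosen representatives.\<close>
  have compare: "u \<le> v \<longleftrightarrow> (f x - f y) / real m \<le> (f x' - f y') / real n"
    if m: "m > 0" "m \<cdot>\<^sub>N u = aovs_of x - aovs_of y" and n: "n > 0" "n \<cdot>\<^sub>N v = aovs_of x' - aovs_of y'"
    for u v :: "'a oag ovs aovs" and m n x y x' y'
  proof -
    have "u \<le> v \<longleftrightarrow> (m * n) \<cdot>\<^sub>N u \<le> (m * n) \<cdot>\<^sub>N v"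
      using m(1) n(1) nmult_mono nmult_le_cancel[of "m * n" u v] by auto
    also have "(m * n) \<cdot>\<^sub>N u = n \<cdot>\<^sub>N m \<cdot>\<^sub>N u" by (simp add: nmult_nmult mult.commute)
    also have "(m * n) \<cdot>\<^sub>N v = m \<cdot>\<^sub>N n \<cdot>\<^sub>N v" by (simp add: nmult_nmult)
    also have "n \<cdot>\<^sub>N m \<cdot>\<^sub>N u \<le> m \<cdot>\<^sub>N n \<cdot>\<^sub>N v \<longleftrightarrow>
        aovs_of (n \<cdot>\<^sub>N x + m \<cdot>\<^sub>N y') \<le> aovs_of (m \<cdot>\<^sub>N x' + n \<cdot>\<^sub>N y)"
      unfolding m(2) n(2) by (simp add: aovs_of_add aovs_of_nmult nmult_diff algebra_simps)
    also have "\<dots> \<longleftrightarrow> real n * f x + real m * f y' \<le> real m * f x' + real n * f y"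
      unfolding aovs_of_le_iff le functional_add[OF f] functional_nmult[OF f] by (rule refl)
    also have "\<dots> \<longleftrightarrow> (f x - f y) / real m \<le> (f x' - f y') / real n"
      using m(1) n(1) by (simp add: field_simps)
    finally show ?thesis .
  qed
  have h_le: "u \<le> v \<longleftrightarrow> h u \<le> h v" for u v
    unfolding h_def using rep[of u] rep[of v] by (intro compare) auto
  have h_eq: "h u = (f x - f y) / real n" if "n > 0" "n \<cdot>\<^sub>N u = aovs_of x - aovs_of y" for u n x y
    unfolding h_def
    using compare[OF that, of "N u" u "X u" "Y u"] compare[OF _ _ that, of "N u" u "X u" "Y u"] rep[of u]
    by (intro order.antisym) auto
  have "h (u + v) = h u + h v" for u v
  proof -
    have "N u * N v > 0" using rep by simp
    moreover have "(N u * N v) \<cdot>\<^sub>N (u + v) = N v \<cdot>\<^sub>N N u \<cdot>\<^sub>N u + N u \<cdot>\<^sub>N N v \<cdot>\<^sub>N v"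
      by (simp add: nmult_add_right nmult_nmult mult.commute)
    moreover have "\<dots> = aovs_of (N v \<cdot>\<^sub>N X u + N u \<cdot>\<^sub>N X v) - aovs_of (N v \<cdot>\<^sub>N Y u + N u \<cdot>\<^sub>N Y v)"
      using rep[of u] rep[of v] by (simp add: aovs_of_add aovs_of_nmult nmult_diff)
    ultimately have "h (u + v) = (f (N v \<cdot>\<^sub>N X u + N u \<cdot>\<^sub>N X v) - f (N v \<cdot>\<^sub>N Y u + N u \<cdot>\<^sub>N Y v)) / real (N u * N v)"
      by (intro h_eq) simp_all
    then show ?thesis
      unfolding h_def[of u] h_def[of v] using rep[of u] rep[of v]
      by (simp add: functional_add[OF f] functional_nmult[OF f] field_simps)
  qed
  moreover have "h 0 = 0" using h_eq[of 1 0 0 0] by simp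
  ultimately have "functional h" unfolding functional_def using h_le by blast
  then show "numerical TYPE('a oag ovs aovs)" unfolding numerical_def using h_le by blast
qed


section \<open>Uniqueness of functionals\<close>

lemma functional_eq_zero:
  assumes "functional f" "f d = 0"
  shows "f x = 0"
proof -
  obtain n where "x \<le> n \<cdot>\<^sub>N d" using bounded .
  then have "f x \<le> real n * f d"
    using functional_mono[OF assms(1)] by (fastforce simp: functional_nmult[OF assms(1)])
  then show ?thesis using assms(2) functional_nonneg[OF assms(1), of x] by simp
qed

text \<open>
  The exact rates between \<open>x\<close> and \<open>d\<close> computed from \<open>f\<close> bound the values of any other
  functional from both sides, with the same ratio. The degenerate values are covered by the order:
  \<open>f x = 0\<close> gives \<open>x \<preceq> 0\<close>, so that all functionals vanish at \<open>x\<close>.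
\<close>

lemma order_determined_proportional:
  assumes f: "order_determined_by f" and g: "functional g"
  shows "\<exists>c. g = (\<lambda>x. c * f x)"
proof (cases "f d = 0")
  have func: "functional f" and le: "\<And>x y. x \<preceq> y \<longleftrightarrow> f x \<le> f y"
    using f by (auto simp: order_determined_by_def)
  case True
  then have "d \<preceq> 0" by (simp add: le functional_zero[OF func])
  then have "g d \<le> 0" using functional_regularized_le[OF g] functional_zero[OF g] by fastforce
  then have "g d = 0" using functional_nonneg[OF g, of d] by simp
  then have "g = (\<lambda>x. 0 * f x)" using functional_eq_zero[OF g] by auto
  then show ?thesis by blast
next
  have func: "functional f" and le: "\<And>x y. x \<preceq> y \<longleftrightarrow> f x \<le> f y"
    using f by (auto simp: order_determined_by_def)
  case False
  then have d: "f d > 0" using functional_nonneg[OF func, of d] by simp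
  have "g x = g d / f d * f x" for x
  proof (rule order.antisym)
    have x: "0 \<le> f x" by (rule functional_nonneg[OF func])
    have "f x / f d * g d \<le> g x"
      using Rmax_functional[OF g, of x d] d x by (simp add: Rmax_numerical[OF f])
    then show "g d / f d * f x \<le> g x" by (simp add: mult.commute)
    show "g x \<le> g d / f d * f x"
    proof (cases "f x = 0")
      case True
      then have "x \<preceq> 0" by (simp add: le functional_zero[OF func])
      then have "g x \<le> g 0" by (rule functional_regularized_le[OF g])
      then show ?thesis using True by (simp add: functional_zero[OF g])
    next
      case False
      then have "f d / f x * g x \<le> g d"
        using Rmax_functional[OF g, of d x] d x by (simp add: Rmax_numerical[OF f])
      then show ?thesis using False x d by (simp add: field_simps)
    qed
  qed
  then show ?thesis by blast
qed

text \<open>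
  Functionals on a positive monoid are nonnegative, so the scalars may be taken nonnegative and
  a comparison under \<open>f\<close> passes to all functionals.
\<close>

lemma order_determined_of_proportional:
  assumes f: "functional f" and multiple: "\<And>g. functional g \<Longrightarrow> \<exists>c. g = (\<lambda>x. c * f x)"
  shows "order_determined_by f"
  unfolding order_determined_by_def regularized_le_iff_functionals
proof (intro conjI allI iffI impI)
  fix x y :: 'a and g :: "'a \<Rightarrow> real" assume le: "f x \<le> f y" and g: "functional g"
  obtain c where c: "g = (\<lambda>x. c * f x)" using multiple[OF g] by blast
  show "g x \<le> g y"
  proof (cases "f d = 0")
    case True
    then show ?thesis using functional_eq_zero[OF f] by (simp add: c)
  next
    case False
    then have "0 < f d" using functional_nonneg[OF f, of d] by simp
    moreover have "0 \<le> c * f d" using functional_nonneg[OF g, of d] by (simp add: c)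
    ultimately have "0 \<le> c" by (simp add: zero_le_mult_iff)
    then show ?thesis using le by (simp add: c mult_left_mono)
  qed
qed (use f in auto)

text \<open>
  A finite rate to \<open>y\<close> means that some functional is nonzero at \<open>y\<close>, so \<open>f\<close>, of which it is a
  multiple, is positive there. Thus both rates are given by the quotient formula.
\<close>

lemma reciprocal_rates:
  assumes f: "order_determined_by f" and fin: "Rmax_reg d x y < \<infinity>" "Rmax_reg d y x < \<infinity>"
  shows "Rmax_reg d x y * Rmax_reg d y x = 1"
proof -
  have pos: "f b > 0" if "Rmax_reg d a b < \<infinity>" for a b
  proof -
    have func: "functional f" using f by (simp add: order_determined_by_def)
    have "Rmax_reg d a b \<noteq> \<infinity>" using that by auto
    then obtain g where "functional g" "g b \<noteq> 0" unfolding Rmax_infinite_iff by blast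
    then have "f b \<noteq> 0" using order_determined_proportional[OF f] by fastforce
    then show ?thesis using functional_nonneg[OF func, of b] by simp
  qed
  show ?thesis
    using pos[OF fin(1)] pos[OF fin(2)]
    by (simp add: Rmax_numerical[OF f] flip: ennreal_mult)
qed

text \<open>
  With \<open>R\<close> and \<open>S\<close> the rates from \<open>d\<close> to \<open>x\<close> and back, every functional satisfies
  \<open>R f(x) \<le> f(d)\<close> and \<open>S f(d) \<le> f(x)\<close>. If \<open>R S = 1\<close>, these say
  \<open>f(x) = f(d) / R\<close>; and if \<open>R\<close> is infinite, all functionals vanish at \<open>x\<close>.
\<close>

lemma proportional_of_reciprocal_rates:
  assumes recip: "\<And>x. Rmax_reg d d x < \<infinity> \<Longrightarrow> Rmax_reg d d x * Rmax_reg d x d = 1"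
  shows "\<exists>f :: 'a \<Rightarrow> real. functional f \<and> (\<forall>g. functional g \<longrightarrow> (\<exists>c. g = (\<lambda>x. c * f x)))"
proof -
  define r where "r x = (if Rmax_reg d d x = \<infinity> then 0 else 1 / enn2real (Rmax_reg d d x))" for x
  have ratio: "f x = f d * r x" if f: "functional f" for f x
  proof (cases "Rmax_reg d d x = \<infinity>")
    case True
    then show ?thesis using f Rmax_infinite_iff[of d x] by (simp add: r_def)
  next
    case False
    then have fin: "Rmax_reg d d x < \<infinity>" by (simp add: less_top)
    note one = recip[OF fin]
    have "Rmax_reg d x d \<noteq> \<infinity>"
      using one fin by (auto simp: ennreal_mult_top split: if_splits)
    then have fin': "Rmax_reg d x d < \<infinity>" by (simp add: less_top)
    define R S where "R = enn2real (Rmax_reg d d x)" and "S = enn2real (Rmax_reg d x d)"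
    have "R * S = 1" unfolding R_def S_def enn2real_mult[symmetric] one by simp
    moreover have "0 \<le> R" by (simp add: R_def)
    ultimately have "R > 0" by (auto simp: less_le)
    with \<open>R * S = 1\<close> have RS: "R > 0" "S = 1 / R" by (simp_all add: field_simps)
    have "R * f x \<le> f d" "S * f d \<le> f x"
      using Rmax_functional[OF f fin] Rmax_functional[OF f fin'] by (simp_all add: R_def S_def)
    then have "f x = f d / R" using RS by (simp add: field_simps)
    then show ?thesis using False by (simp add: r_def R_def)
  qed
  show ?thesis
  proof (cases "\<exists>f :: 'a \<Rightarrow> real. functional f \<and> f d \<noteq> 0")
    case True
    then obtain f :: "'a \<Rightarrow> real" where f: "functional f" "f d \<noteq> 0" by blast
    have "\<exists>c. g = (\<lambda>x. c * f x)" if "functional g" for g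
    proof (intro exI ext)
      show "g x = g d / f d * f x" for x
        using f(2) ratio[OF that, of x] ratio[OF f(1), of x] by simp
    qed
    then show ?thesis using f(1) by blast
  next
    case False
    then have "g = (\<lambda>x. 0 * 0)" if "functional g" for g :: "'a \<Rightarrow> real"
      using that functional_eq_zero[OF that] by auto
    moreover have "functional (\<lambda>x :: 'a. 0)" by (simp add: functional_def)
    ultimately show ?thesis by blast
  qed
qed

text \<open>
  This makes the condition on pairs \<open>(d, x)\<close> a special case of the one on all pairs, where both
  rates are required to be finite. It holds because a functional that is nonzero at \<open>x\<close> is
  nonzero at the generator.
\<close>

lemma finite_rate_to_generator:
  assumes "Rmax_reg d d x < \<infinity>"
  shows "Rmax_reg d x d < \<infinity>"
proof -
  have "Rmax_reg d d x \<noteq> \<infinity>" using assms by auto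
  then obtain f where f: "functional f" "f x \<noteq> 0" unfolding Rmax_infinite_iff by blast
  then have "f d \<noteq> 0" using functional_eq_zero by blast
  then have "Rmax_reg d x d \<noteq> \<infinity>" using f(1) Rmax_infinite_iff[of x d] by blast
  then show ?thesis by (simp add: less_top)
qed

end


theorem theorem9p9:
  fixes d :: "'a::ordered_comm_monoid_add"
  assumes positive: "\<forall>x::'a. x \<ge> 0"
    and generator: "generator d"
  shows
    "(numerical TYPE('a oag ovs aovs) \<longleftrightarrow>
        (\<exists>f::'a \<Rightarrow> real. functional f \<and>
           (\<forall>g. functional g \<longrightarrow> (\<exists>c::real. g = (\<lambda>x. c * f x))))) \<and>
     (numerical TYPE('a oag ovs aovs) \<longleftrightarrow>
        (\<forall>f::'a \<Rightarrow> real. functional f \<and> f \<noteq> (\<lambda>x. 0) \<longrightarrow>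
           (\<forall>g. functional g \<longrightarrow> (\<exists>c::real. g = (\<lambda>x. c * f x))))) \<and>
     (numerical TYPE('a oag ovs aovs) \<longleftrightarrow>
        (\<forall>x. Rmax_reg d d x < \<infinity> \<longrightarrow> Rmax_reg d d x * Rmax_reg d x d = 1)) \<and>
     (numerical TYPE('a oag ovs aovs) \<longleftrightarrow>
        (\<forall>x y. Rmax_reg d x y < \<infinity> \<and> Rmax_reg d y x < \<infinity> \<longrightarrow>
           Rmax_reg d x y * Rmax_reg d y x = 1)) \<and>
     (numerical TYPE('a oag ovs aovs) \<longleftrightarrow>
        (\<exists>f::'a \<Rightarrow> real. functional f \<and> (\<forall>x. f x \<ge> 0) \<and>
           (\<forall>x y. aovs_of x \<ge> aovs_of y \<longleftrightarrow> f x \<ge> f y)))"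
proof -
  interpret generated_positive_monoid d
    using positive generator by unfold_locales auto
  let ?a = "numerical TYPE('a oag ovs aovs)"
  let ?b = "\<exists>f::'a \<Rightarrow> real. functional f \<and>
    (\<forall>g. functional g \<longrightarrow> (\<exists>c::real. g = (\<lambda>x. c * f x)))"
  let ?c = "\<forall>f::'a \<Rightarrow> real. functional f \<and> f \<noteq> (\<lambda>x. 0) \<longrightarrow>
    (\<forall>g. functional g \<longrightarrow> (\<exists>c::real. g = (\<lambda>x. c * f x)))"
  let ?d = "\<forall>x. Rmax_reg d d x < \<infinity> \<longrightarrow> Rmax_reg d d x * Rmax_reg d x d = 1"
  let ?e = "\<forall>x y. Rmax_reg d x y < \<infinity> \<and> Rmax_reg d y x < \<infinity> \<longrightarrow>
    Rmax_reg d x y * Rmax_reg d y x = 1"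
  let ?f = "\<exists>f::'a \<Rightarrow> real. functional f \<and> (\<forall>x. f x \<ge> 0) \<and>
    (\<forall>x y. aovs_of x \<ge> aovs_of y \<longleftrightarrow> f x \<ge> f y)"
  have ab: ?b if ?a
    using that order_determined_proportional unfolding numerical_iff order_determined_by_def by blast
  have ba: ?a if ?b
    using that order_determined_of_proportional unfolding numerical_iff by blast
  have bc: ?c if b: ?b
  proof (intro allI impI)
    fix f g :: "'a \<Rightarrow> real"
    assume f: "functional f \<and> f \<noteq> (\<lambda>x. 0)" and g: "functional g"
    obtain h :: "'a \<Rightarrow> real" where h: "\<And>g. functional g \<Longrightarrow> \<exists>c. g = (\<lambda>x. c * h x)"
      using b by blast
    obtain c where c: "f = (\<lambda>x. c * h x)" using h f by blast
    obtain c' where c': "g = (\<lambda>x. c' * h x)" using h g by blast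
    have "c \<noteq> 0" using f c by auto
    then have "g = (\<lambda>x. c' / c * f x)" by (simp add: c c')
    then show "\<exists>c. g = (\<lambda>x. c * f x)" by blast
  qed
  have cb: ?b if ?c
  proof (cases "\<exists>f::'a \<Rightarrow> real. functional f \<and> f \<noteq> (\<lambda>x. 0)")
    case True
    then show ?thesis using that by blast
  next
    case False
    then have "g = (\<lambda>x. 0 * 0)" if "functional g" for g :: "'a \<Rightarrow> real"
      using that by auto
    moreover have "functional (\<lambda>x :: 'a. 0)" by (simp add: functional_def)
    ultimately show ?thesis by blast
  qed
  have ae: ?e if ?a
    using that reciprocal_rates unfolding numerical_iff by blast
  have ed: ?d if ?e
    using that finite_rate_to_generator by blast
  have db: ?b if ?d
    using that proportional_of_reciprocal_rates by blast
  have af: "?a \<longleftrightarrow> ?f"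
    unfolding numerical_iff order_determined_by_def aovs_of_le_iff
    using functional_nonneg by blast
  show ?thesis using ab ba bc cb ae ed db af by argo
qed

end
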